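(* Let $Q$ be a commutative Noetherian monoid. Any coprincipal congruence $\sim$ on $Q$ is the common refinement (intersection of equivalence relations) of the soccular components cogenerated by its protected witnesses.
   Context: Monoids. $Q$ is commutative and Noetherian, written additively. A congruence on $Q$ is an equivalence relation $\sim$ with $a\sim b\Rightarrow a+c\sim b+c$ for all $c\in Q$. An ideal of a monoid is a subset closed under adding arbitrary elements; $\langle q\rangle$ is the ideal generated by $q$. A nil is an absorbing element $\infty$; an element is nilpotent if some positive multiple is nil; $c$ is cancellative if $a+c=b+c\Rightarrow a=b$. A prime $P\subset Q$ is a proper, possibly empty, ideal whose complement is a submonoid. $Q_P$ is the localization of $Q$ along $P$ (inverting $Q\smallsetminus P$); $\overline Q=Q/{\sim}$, $\overline Q_P=Q_P/{\sim}$, and $\bar q$ denotes the image of $q\in Q$ in $\overline Q$ (or in $\overline Q_P$ when so indicated). Green's preorder: $a\le b$ iff $\langle b\rangle\subseteq\langle a\rangle$. Witnesses. For a congruence $\sim$ and a prime $P$: $q\in Q$ is an aide for $w\in Q$ and a generator $p\in P$ if $\bar w\ne\bar q$, $\bar w+\bar p=\bar q+\bar p$, and $\bar q$ is maximal in the set $\{\bar q,\bar w\}$ (under Green's preorder); $q$ is a key aide for $w$ if it is an aide for $w$ for each generator of $P$; $w$ is a key witness for $P$ if it has a key aide. A key witness $w$ is a cogenerator of $\sim$ if $w+p$ is nil modulo $\sim$ for all $p\in P$. Congruences. $\sim$ is $P$-primary if every $p\in P$ is nilpotent in $\overline Q$ and every $f\in Q\smallsetminus P$ is cancellative in $\overline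 Q$. A $P$-primary congruence is mesoprimary if every element $q$ of $\overline Q$ is partly cancellative, i.e. $q+a=q+b\ne\infty\Rightarrow a=b$ for all cancellative $a,b\in\overline Q$. It is coprincipal (or $P$-coprincipal) if it is mesoprimary and every cogenerator for $\sim$ generates the same ideal in $\overline Q$. Coprincipal component. The coprincipal component $\sim_w^P$ of $\sim$ cogenerated by $w$ along $P$ relates $a,b\in Q$ if one of the following holds: (a) both $\bar a$ and $\bar b$ generate an ideal not containing $\bar w$ in $\overline Q_P$; or (b) $\bar a$ and $\bar b$ differ by a unit in $\overline Q_P$ and $\bar a+\bar c=\bar b+\bar c=\bar w$ for some $\bar c\in\overline Q_P$. Soccular collapse and closure. For a $P$-coprincipal congruence $\sim$ with cogenerator $w$, the (first) soccular collapse of $\sim$ is the congruence $\approx$ that sets $a\approx b$ if $a,b\notin\langle w\rangle$ and $a+p\sim b+p$ for all $p\in P$. The $i$-th soccular collapse of $\sim$ is the soccular collapse of the $(i-1)$st soccular collapse of $\sim$. The soccular closure of $\sim$ is the congruence refined by $\sim$ that additionally joins any $a$ and $b$ related under some soccular collapse of $\sim$. An element $a\in Q$ is a protected witness for a coprincipal congruence $\sim$ if it is a key witness for the $i$-th soccular collapse of $\sim$ for some $i\ge1$. For a $P$-coprincipal congruence $\sim$, the soccular component $\overline{\sim}_w^P$ of $\sim$ cogenerated by $w$ along $P$ is the soccular closure of the coprincipal component $\sim_w^P$.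
   Formalization: Protected witnesses also include the key witnesses for ∼ itself (the 0-th soccular collapse), since with i ≥ 1 only the claim fails; in the soccular collapse, ⟨w⟩ is read as the ideal of the quotient generated by the image of w. *)

theory Defs
  imports "HOL-Algebra.Group"
begin

text \<open>
  Monoids are those of HOL-Algebra, hence written multiplicatively: \<open>a + b\<close>, \<open>0\<close> and \<open>n * a\<close>
  of the additive notation are \<open>a \<otimes> b\<close>, \<open>\<one>\<close> and \<open>a [^] n\<close> here.
\<close>

section \<open>Commutative monoids\<close>

definition monoid_ideal :: "('a, 'm) monoid_scheme \<Rightarrow> 'a set \<Rightarrow> bool" where
  "monoid_ideal M I \<longleftrightarrow> I \<subseteq> carrier M \<and> (\<forall>x\<in>I. \<forall>c\<in>carrier M. x \<otimes>\<^bsub>M\<^esub> c \<in> I)"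

definition ideal_gen :: "('a, 'm) monoid_scheme \<Rightarrow> 'a set \<Rightarrow> 'a set" where
  "ideal_gen M G = {x \<otimes>\<^bsub>M\<^esub> c | x c. x \<in> G \<and> c \<in> carrier M}"

abbreviation pideal :: "('a, 'm) monoid_scheme \<Rightarrow> 'a \<Rightarrow> 'a set" where
  "pideal M q \<equiv> ideal_gen M {q}"

definition prime_ideal :: "('a, 'm) monoid_scheme \<Rightarrow> 'a set \<Rightarrow> bool" where
  "prime_ideal M P \<longleftrightarrow> monoid_ideal M P \<and> P \<noteq> carrier M \<and> submonoid (carrier M - P) M"

definition is_nil :: "('a, 'm) monoid_scheme \<Rightarrow> 'a \<Rightarrow> bool" where
  "is_nil M z \<longleftrightarrow> z \<in> carrier M \<and> (\<forall>c\<in>carrier M. z \<otimes>\<^bsub>M\<^esub> c = z)"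

definition nilpotent :: "('a, 'm) monoid_scheme \<Rightarrow> 'a \<Rightarrow> bool" where
  "nilpotent M x \<longleftrightarrow> x \<in> carrier M \<and> (\<exists>n::nat. n > 0 \<and> is_nil M (x [^]\<^bsub>M\<^esub> n))"

definition cancellative :: "('a, 'm) monoid_scheme \<Rightarrow> 'a \<Rightarrow> bool" where
  "cancellative M c \<longleftrightarrow> c \<in> carrier M \<and>
     (\<forall>a\<in>carrier M. \<forall>b\<in>carrier M. a \<otimes>\<^bsub>M\<^esub> c = b \<otimes>\<^bsub>M\<^esub> c \<longrightarrow> a = b)"

definition partly_cancellative :: "('a, 'm) monoid_scheme \<Rightarrow> 'a \<Rightarrow> bool" where
  "partly_cancellative M q \<longleftrightarrow> q \<in> carrier M \<and>
     (\<forall>a b. cancellative M a \<and> cancellative M b \<and>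
        q \<otimes>\<^bsub>M\<^esub> a = q \<otimes>\<^bsub>M\<^esub> b \<and> \<not> is_nil M (q \<otimes>\<^bsub>M\<^esub> a) \<longrightarrow> a = b)"

definition green_le :: "('a, 'm) monoid_scheme \<Rightarrow> 'a \<Rightarrow> 'a \<Rightarrow> bool" where
  "green_le M a b \<longleftrightarrow> pideal M b \<subseteq> pideal M a"

text \<open>Maximality is with respect to a preorder: elements above \<open>q\<close> are equivalent to \<open>q\<close>.\<close>

definition green_maximal_in :: "('a, 'm) monoid_scheme \<Rightarrow> 'a set \<Rightarrow> 'a \<Rightarrow> bool" where
  "green_maximal_in M S q \<longleftrightarrow> q \<in> S \<and> (\<forall>x\<in>S. green_le M q x \<longrightarrow> green_le M x q)"

section \<open>Congruences, quotients, localizations\<close>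

definition congruence :: "('a, 'm) monoid_scheme \<Rightarrow> 'a rel \<Rightarrow> bool" where
  "congruence M R \<longleftrightarrow> equiv (carrier M) R \<and>
     (\<forall>a b c. (a, b) \<in> R \<and> c \<in> carrier M \<longrightarrow> (a \<otimes>\<^bsub>M\<^esub> c, b \<otimes>\<^bsub>M\<^esub> c) \<in> R)"

text \<open>A commutative monoid is Noetherian if its congruences satisfy the ascending chain condition.\<close>

definition noetherian_monoid :: "('a, 'm) monoid_scheme \<Rightarrow> bool" where
  "noetherian_monoid M \<longleftrightarrow>
     (\<forall>C::nat \<Rightarrow> 'a rel. (\<forall>i. congruence M (C i)) \<and> (\<forall>i. C i \<subseteq> C (Suc i)) \<longrightarrow>
        (\<exists>n. \<forall>m\<ge>n. C m = C n))"

definition quot :: "('a, 'm) monoid_scheme \<Rightarrow> 'a rel \<Rightarrow> 'a set monoid" where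
  "quot M R = \<lparr>carrier = carrier M // R,
     mult = (\<lambda>X Y. \<Union>x\<in>X. \<Union>y\<in>Y. R `` {x \<otimes>\<^bsub>M\<^esub> y}),
     one = R `` {\<one>\<^bsub>M\<^esub>}\<rparr>"

text \<open>
  The pair \<open>(a, f)\<close> stands for the fraction \<open>a - f\<close>. Two fractions have the same image in \<open>Q\<^sub>P/R\<close>
  iff they become related under \<open>R\<close> after clearing denominators and adding some
  \<open>h \<in> Q - P\<close>; so \<open>loc_quot Q P R\<close> is \<open>Q\<^sub>P/R\<close>, and \<open>Q\<^sub>P\<close> itself for the identity congruence \<open>R\<close>.
\<close>

definition frac_rel :: "('a, 'm) monoid_scheme \<Rightarrow> 'a set \<Rightarrow> 'a rel \<Rightarrow> ('a \<times> 'a) rel" where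
  "frac_rel Q P R = {((a, f), (b, g)).
     a \<in> carrier Q \<and> b \<in> carrier Q \<and> f \<in> carrier Q - P \<and> g \<in> carrier Q - P \<and>
     (\<exists>h\<in>carrier Q - P. (a \<otimes>\<^bsub>Q\<^esub> g \<otimes>\<^bsub>Q\<^esub> h, b \<otimes>\<^bsub>Q\<^esub> f \<otimes>\<^bsub>Q\<^esub> h) \<in> R)}"

definition loc_quot ::
  "('a, 'm) monoid_scheme \<Rightarrow> 'a set \<Rightarrow> 'a rel \<Rightarrow> ('a \<times> 'a) set monoid" where
  "loc_quot Q P R = quot (Q \<times>\<times> Q\<lparr>carrier := carrier Q - P\<rparr>) (frac_rel Q P R)"

definition loc_image ::
  "('a, 'm) monoid_scheme \<Rightarrow> 'a set \<Rightarrow> 'a rel \<Rightarrow> 'a \<Rightarrow> ('a \<times> 'a) set" where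
  "loc_image Q P R q = frac_rel Q P R `` {(q, \<one>\<^bsub>Q\<^esub>)}"

section \<open>Witnesses\<close>

definition aide ::
  "('a, 'm) monoid_scheme \<Rightarrow> 'a rel \<Rightarrow> 'a \<Rightarrow> 'a \<Rightarrow> 'a \<Rightarrow> bool" where
  "aide Q R q w p \<longleftrightarrow>
     R `` {w} \<noteq> R `` {q} \<and>
     R `` {w} \<otimes>\<^bsub>quot Q R\<^esub> R `` {p} = R `` {q} \<otimes>\<^bsub>quot Q R\<^esub> R `` {p} \<and>
     green_maximal_in (quot Q R) {R `` {q}, R `` {w}} (R `` {q})"

text \<open>
  The choice of the generating set \<open>G\<close> of \<open>P\<close> is immaterial: equality of \<open>w + p\<close> and \<open>q + p\<close>
  modulo \<open>R\<close> passes to the multiples of \<open>p\<close> (see \<open>key_aide_iff\<close> below).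
\<close>

definition key_aide ::
  "('a, 'm) monoid_scheme \<Rightarrow> 'a set \<Rightarrow> 'a rel \<Rightarrow> 'a \<Rightarrow> 'a \<Rightarrow> bool" where
  "key_aide Q P R q w \<longleftrightarrow> (\<exists>G \<subseteq> carrier Q. ideal_gen Q G = P \<and> (\<forall>p\<in>G. aide Q R q w p))"

definition key_witness ::
  "('a, 'm) monoid_scheme \<Rightarrow> 'a set \<Rightarrow> 'a rel \<Rightarrow> 'a \<Rightarrow> bool" where
  "key_witness Q P R w \<longleftrightarrow> w \<in> carrier Q \<and> (\<exists>q\<in>carrier Q. key_aide Q P R q w)"

definition cogenerator ::
  "('a, 'm) monoid_scheme \<Rightarrow> 'a set \<Rightarrow> 'a rel \<Rightarrow> 'a \<Rightarrow> bool" where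
  "cogenerator Q P R w \<longleftrightarrow>
     key_witness Q P R w \<and> (\<forall>p\<in>P. is_nil (quot Q R) (R `` {w \<otimes>\<^bsub>Q\<^esub> p}))"

section \<open>Primary, mesoprimary and coprincipal congruences\<close>

definition primary ::
  "('a, 'm) monoid_scheme \<Rightarrow> 'a set \<Rightarrow> 'a rel \<Rightarrow> bool" where
  "primary Q P R \<longleftrightarrow> prime_ideal Q P \<and> congruence Q R \<and>
     (\<forall>p\<in>P. nilpotent (quot Q R) (R `` {p})) \<and>
     (\<forall>f\<in>carrier Q - P. cancellative (quot Q R) (R `` {f}))"

definition mesoprimary ::
  "('a, 'm) monoid_scheme \<Rightarrow> 'a set \<Rightarrow> 'a rel \<Rightarrow> bool" where
  "mesoprimary Q P R \<longleftrightarrow> primary Q P R \<and>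
     (\<forall>x\<in>carrier (quot Q R). partly_cancellative (quot Q R) x)"

definition coprincipal ::
  "('a, 'm) monoid_scheme \<Rightarrow> 'a set \<Rightarrow> 'a rel \<Rightarrow> bool" where
  "coprincipal Q P R \<longleftrightarrow> mesoprimary Q P R \<and>
     (\<forall>v w. cogenerator Q P R v \<and> cogenerator Q P R w \<longrightarrow>
        pideal (quot Q R) (R `` {v}) = pideal (quot Q R) (R `` {w}))"

definition coprincipal_component ::
  "('a, 'm) monoid_scheme \<Rightarrow> 'a set \<Rightarrow> 'a rel \<Rightarrow> 'a \<Rightarrow> 'a rel" where
  "coprincipal_component Q P R w =
     (let L = loc_quot Q P R; i = loc_image Q P R in
      {(a, b). a \<in> carrier Q \<and> b \<in> carrier Q \<and>
         (i w \<notin> pideal L (i a) \<and> i w \<notin> pideal L (i b) \<or>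
          (\<exists>u\<in>Units L. i b = i a \<otimes>\<^bsub>L\<^esub> u) \<and>
          (\<exists>c\<in>carrier L. i a \<otimes>\<^bsub>L\<^esub> c = i w \<and> i b \<otimes>\<^bsub>L\<^esub> c = i w))})"

section \<open>Soccular collapse and closure\<close>

text \<open>
  The collapse enlarges \<open>R\<close>. The ideal avoided by \<open>a\<close> and \<open>b\<close> is taken in the quotient by \<open>R\<close>, so
  that the condition depends only on classes modulo \<open>R\<close>; as \<open>R\<close> is meant to be coprincipal, this
  ideal does not depend on the cogenerator \<open>w\<close>.
\<close>

definition soccular_collapse ::
  "('a, 'm) monoid_scheme \<Rightarrow> 'a set \<Rightarrow> 'a rel \<Rightarrow> 'a rel" where
  "soccular_collapse Q P R =
     R \<union> {(a, b). a \<in> carrier Q \<and> b \<in> carrier Q \<and>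
            (\<exists>w. cogenerator Q P R w \<and>
               R `` {a} \<notin> pideal (quot Q R) (R `` {w}) \<and>
               R `` {b} \<notin> pideal (quot Q R) (R `` {w})) \<and>
            (\<forall>p\<in>P. (a \<otimes>\<^bsub>Q\<^esub> p, b \<otimes>\<^bsub>Q\<^esub> p) \<in> R)}"

text \<open>The 0-th collapse is \<open>R\<close> itself.\<close>

definition iter_collapse ::
  "('a, 'm) monoid_scheme \<Rightarrow> 'a set \<Rightarrow> nat \<Rightarrow> 'a rel \<Rightarrow> 'a rel" where
  "iter_collapse Q P i R = (soccular_collapse Q P ^^ i) R"

definition soccular_closure ::
  "('a, 'm) monoid_scheme \<Rightarrow> 'a set \<Rightarrow> 'a rel \<Rightarrow> 'a rel" where
  "soccular_closure Q P R = R \<union> (\<Union>i\<in>{1..}. iter_collapse Q P i R)"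

text \<open>
  The index starts at \<open>i = 0\<close>, that is, key witnesses for \<open>R\<close> itself are protected. They are the
  elements joined by the first collapse and cannot be dropped: for the congruence on \<open>\<nat>\<^sup>2\<close>
  with classes \<open>{0}\<close>, \<open>{x}\<close>, \<open>{y}\<close>, \<open>{degree 2}\<close>, \<open>{degree \<ge> 3}\<close>, the first collapse joins \<open>x\<close> and \<open>y\<close>,
  the key witnesses for every collapse with \<open>i \<ge> 1\<close> have degree 2, and their soccular components
  all join \<open>x\<close> and \<open>y\<close>.
\<close>

definition protected_witness ::
  "('a, 'm) monoid_scheme \<Rightarrow> 'a set \<Rightarrow> 'a rel \<Rightarrow> 'a \<Rightarrow> bool" where
  "protected_witness Q P R a \<longleftrightarrow> (\<exists>i. key_witness Q P (iter_collapse Q P i R) a)"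

definition soccular_component ::
  "('a, 'm) monoid_scheme \<Rightarrow> 'a set \<Rightarrow> 'a rel \<Rightarrow> 'a \<Rightarrow> 'a rel" where
  "soccular_component Q P R w = soccular_closure Q P (coprincipal_component Q P R w)"

section \<open>Elementary facts\<close>

lemma quot_mult_class:
  assumes "comm_monoid Q" "congruence Q R" "a \<in> carrier Q" "b \<in> carrier Q"
  shows "R `` {a} \<otimes>\<^bsub>quot Q R\<^esub> R `` {b} = R `` {a \<otimes>\<^bsub>Q\<^esub> b}"
proof -
  interpret comm_monoid Q by fact
  have eq: "equiv (carrier Q) R"
    and tr: "\<And>a b c. (a, b) \<in> R \<Longrightarrow> c \<in> carrier Q \<Longrightarrow> (a \<otimes>\<^bsub>Q\<^esub> c, b \<otimes>\<^bsub>Q\<^esub> c) \<in> R"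
    using assms(2) by (auto simp: congruence_def)
  have sub: "R \<subseteq> carrier Q \<times> carrier Q"
    using eq by (rule equiv_type)
  have "R `` {x \<otimes>\<^bsub>Q\<^esub> y} = R `` {a \<otimes>\<^bsub>Q\<^esub> b}" if "(a, x) \<in> R" "(b, y) \<in> R" for x y
  proof -
    have x: "x \<in> carrier Q" and y: "y \<in> carrier Q" using that sub by auto
    have "(a \<otimes>\<^bsub>Q\<^esub> b, x \<otimes>\<^bsub>Q\<^esub> b) \<in> R" using tr that(1) assms(4) .
    moreover have "(x \<otimes>\<^bsub>Q\<^esub> b, x \<otimes>\<^bsub>Q\<^esub> y) \<in> R"
      using tr[OF that(2) x] x y assms(4) by (simp add: m_comm)
    ultimately have "(a \<otimes>\<^bsub>Q\<^esub> b, x \<otimes>\<^bsub>Q\<^esub> y) \<in> R"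
      using eq unfolding equiv_def trans_def by blast
    then show ?thesis by (rule equiv_class_eq[OF eq, symmetric])
  qed
  moreover have "a \<in> R `` {a}" "b \<in> R `` {b}"
    using equiv_class_self[OF eq] assms(3,4) by blast+
  ultimately have "(\<Union>x\<in>R `` {a}. \<Union>y\<in>R `` {b}. R `` {x \<otimes>\<^bsub>Q\<^esub> y}) = R `` {a \<otimes>\<^bsub>Q\<^esub> b}"
    by blast
  then show ?thesis by (simp only: quot_def monoid.simps)
qed

lemma key_aide_iff:
  assumes Q: "comm_monoid Q" and R: "congruence Q R" and P: "monoid_ideal Q P"
    and q: "q \<in> carrier Q" and w: "w \<in> carrier Q"
  shows "key_aide Q P R q w \<longleftrightarrow> (\<forall>p\<in>P. aide Q R q w p)"
proof
  interpret comm_monoid Q by fact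
  have eq: "equiv (carrier Q) R" using R by (simp add: congruence_def)
  assume "key_aide Q P R q w"
  then obtain G where G: "G \<subseteq> carrier Q" "ideal_gen Q G = P" and a: "\<forall>p\<in>G. aide Q R q w p"
    by (auto simp: key_aide_def)
  show "\<forall>p\<in>P. aide Q R q w p"
  proof
    fix p assume "p \<in> P"
    then obtain g c where g: "g \<in> G" and c: "c \<in> carrier Q" and p: "p = g \<otimes>\<^bsub>Q\<^esub> c"
      using G(2) by (auto simp: ideal_gen_def)
    have gQ: "g \<in> carrier Q" using g G(1) by blast
    have "R `` {w \<otimes>\<^bsub>Q\<^esub> g} = R `` {q \<otimes>\<^bsub>Q\<^esub> g}"
      using a[rule_format, OF g]
      by (simp only: aide_def quot_mult_class[OF Q R w gQ] quot_mult_class[OF Q R q gQ])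
    then have wg: "(w \<otimes>\<^bsub>Q\<^esub> g, q \<otimes>\<^bsub>Q\<^esub> g) \<in> R"
      by (rule eq_equiv_class[OF _ eq]) (simp add: q gQ)
    have "(w \<otimes>\<^bsub>Q\<^esub> p, q \<otimes>\<^bsub>Q\<^esub> p) \<in> R"
    proof -
      have "((w \<otimes>\<^bsub>Q\<^esub> g) \<otimes>\<^bsub>Q\<^esub> c, (q \<otimes>\<^bsub>Q\<^esub> g) \<otimes>\<^bsub>Q\<^esub> c) \<in> R"
        using R c wg by (simp add: congruence_def)
      then show ?thesis by (simp add: p m_assoc q w c gQ)
    qed
    then have "R `` {w \<otimes>\<^bsub>Q\<^esub> p} = R `` {q \<otimes>\<^bsub>Q\<^esub> p}"
      by (rule equiv_class_eq[OF eq])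
    moreover have "p \<in> carrier Q" using gQ c p by simp
    ultimately have "R `` {w} \<otimes>\<^bsub>quot Q R\<^esub> R `` {p} = R `` {q} \<otimes>\<^bsub>quot Q R\<^esub> R `` {p}"
      by (simp only: quot_mult_class[OF Q R w] quot_mult_class[OF Q R q])
    moreover have "aide Q R q w g" using a g by blast
    ultimately show "aide Q R q w p"
      by (simp only: aide_def simp_thms)
  qed
next
  interpret comm_monoid Q by fact
  assume a: "\<forall>p\<in>P. aide Q R q w p"
  have sub: "P \<subseteq> carrier Q" using P by (simp add: monoid_ideal_def)
  have "ideal_gen Q P = P"
  proof
    show "ideal_gen Q P \<subseteq> P" using P by (auto simp: ideal_gen_def monoid_ideal_def)
    show "P \<subseteq> ideal_gen Q P"
    proof
      fix x assume x: "x \<in> P"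
      then have "x = x \<otimes>\<^bsub>Q\<^esub> \<one>\<^bsub>Q\<^esub>" using sub by (simp add: subset_iff)
      then show "x \<in> ideal_gen Q P" using x one_closed unfolding ideal_gen_def by blast
    qed
  qed
  then show "key_aide Q P R q w" using a sub unfolding key_aide_def by blast
qed

end

theory Submission
  imports Defs
begin

text \<open>
  A non-universal coprincipal congruence \<open>R\<close> makes every element off \<open>P\<close> a unit,
  acting freely on the non-nil elements, and its socle is a single orbit of units. Soccular collapses keep this structure and never
  touch the nil class. The coprincipal component at a non-nil \<open>w\<close> is \<open>R\<close> with all elements not
  dividing \<open>w\<close> sent to nil, so it again has this structure. If \<open>a\<close> and \<open>b\<close> are first joined by
  collapse \<open>i + 1\<close>, one of them, say \<open>b\<close>, does not divide the other modulo the \<open>i\<close>-th collapse (by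
  freeness), so \<open>a\<close> is protected, and \<open>b\<close> but not \<open>a\<close> is nil in the component at \<open>a\<close>. If \<open>a\<close> and
  \<open>b\<close> are never joined, a socle element \<open>w\<close> separates them, its coprincipal component being \<open>R\<close>.
\<close>

section \<open>Quotients by congruences\<close>

text \<open>If every member lay properly inside another, dependent choice would give a strictly
  ascending chain of congruences.\<close>

lemma noetherian_maximal:
  assumes noeth: "noetherian_monoid Q" and C: "\<C> \<noteq> {}" "\<And>C. C \<in> \<C> \<Longrightarrow> congruence Q C"
  shows "\<exists>C\<in>\<C>. \<forall>D\<in>\<C>. C \<subseteq> D \<longrightarrow> D = C"
proof (rule ccontr)
  assume "\<not> ?thesis"
  then have step: "\<exists>D. D \<in> \<C> \<and> C \<subset> D" if "C \<in> \<C>" for C using that by blast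
  have start: "\<exists>C. C \<in> \<C>" using C(1) by blast
  obtain F :: "nat \<Rightarrow> 'a rel" where F: "\<And>n. F n \<in> \<C>" "\<And>n. F n \<subset> F (Suc n)"
    using dependent_nat_choice[of "\<lambda>_ C. C \<in> \<C>" "\<lambda>_ C D. C \<subset> D", OF start step] by metis
  have "\<exists>n. \<forall>m\<ge>n. F m = F n"
    using noeth C(2)[OF F(1)] psubset_imp_subset[OF F(2)] unfolding noetherian_monoid_def
    by (elim allE[of _ F]) blast
  then obtain n where n: "\<forall>m\<ge>n. F m = F n" ..
  show False using n[rule_format, of "Suc n"] F(2)[of n] by simp
qed

locale monoid_congruence = comm_monoid Q for Q (structure) +
  fixes R :: "'a rel"
  assumes cong: "congruence Q R"
begin

lemma equiv_R: "equiv (carrier Q) R"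
  using cong by (simp add: congruence_def)

lemma R_closed: "(a, b) \<in> R \<Longrightarrow> a \<in> carrier Q" "(a, b) \<in> R \<Longrightarrow> b \<in> carrier Q"
  using equiv_type[OF equiv_R] by auto

lemma R_refl: "a \<in> carrier Q \<Longrightarrow> (a, a) \<in> R"
  using equiv_R by (auto simp: equiv_def refl_on_def)

lemma R_sym: "(a, b) \<in> R \<Longrightarrow> (b, a) \<in> R"
  using equiv_R by (auto simp: equiv_def sym_def)

lemma R_trans [trans]: "(a, b) \<in> R \<Longrightarrow> (b, c) \<in> R \<Longrightarrow> (a, c) \<in> R"
  using equiv_R unfolding equiv_def trans_def by blast

lemma R_mult: "(a, b) \<in> R \<Longrightarrow> c \<in> carrier Q \<Longrightarrow> (a \<otimes> c, b \<otimes> c) \<in> R"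
  using cong by (simp add: congruence_def)

lemma R_mult_left: "(a, b) \<in> R \<Longrightarrow> c \<in> carrier Q \<Longrightarrow> (c \<otimes> a, c \<otimes> b) \<in> R"
  using R_mult[of a b c] R_closed[of a b] by (simp add: m_comm)

lemma class_eq_iff:
  "a \<in> carrier Q \<Longrightarrow> b \<in> carrier Q \<Longrightarrow> R `` {a} = R `` {b} \<longleftrightarrow> (a, b) \<in> R"
  by (rule eq_equiv_class_iff[OF equiv_R])

lemma mult_class:
  "a \<in> carrier Q \<Longrightarrow> b \<in> carrier Q \<Longrightarrow> R `` {a} \<otimes>\<^bsub>quot Q R\<^esub> R `` {b} = R `` {a \<otimes> b}"
  by (rule quot_mult_class[OF comm_monoid_axioms cong])

lemma carrier_quot: "carrier (quot Q R) = (\<lambda>a. R `` {a}) ` carrier Q"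
  by (auto simp: quot_def quotient_def)

lemma one_quot: "\<one>\<^bsub>quot Q R\<^esub> = R `` {\<one>}"
  by (simp add: quot_def)

lemma pow_class: "a \<in> carrier Q \<Longrightarrow> R `` {a} [^]\<^bsub>quot Q R\<^esub> (n::nat) = R `` {a [^] n}"
  by (induction n) (simp_all add: one_quot mult_class)

text \<open>Multiply by the inverse \<open>g\<close> of \<open>f\<close> modulo \<open>R\<close>.
  Collapses and coprincipal components inherit such inverses, and their axiom \<open>cancel\<close>
  follows from this.\<close>

lemma cancel_unit:
  assumes ab: "a \<in> carrier Q" "b \<in> carrier Q" and f: "f \<in> carrier Q"
    and g: "g \<in> carrier Q" "(f \<otimes> g, \<one>) \<in> R" and r: "(a \<otimes> f, b \<otimes> f) \<in> R"
  shows "(a, b) \<in> R"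
proof -
  have "(a, a \<otimes> f \<otimes> g) \<in> R"
    using R_sym[OF R_mult_left[OF g(2) ab(1)]] ab f g(1) by (simp add: m_assoc)
  also have "(a \<otimes> f \<otimes> g, b \<otimes> f \<otimes> g) \<in> R" by (rule R_mult[OF r g(1)])
  also have "(b \<otimes> f \<otimes> g, b) \<in> R"
    using R_mult_left[OF g(2) ab(2)] ab f g(1) by (simp add: m_assoc)
  finally show ?thesis .
qed

lemma in_pideal_quot_iff:
  assumes "x \<in> carrier Q" "y \<in> carrier Q"
  shows "R `` {y} \<in> pideal (quot Q R) (R `` {x}) \<longleftrightarrow> (\<exists>c\<in>carrier Q. (x \<otimes> c, y) \<in> R)"
proof -
  have "pideal (quot Q R) (R `` {x}) = (\<lambda>C. R `` {x} \<otimes>\<^bsub>quot Q R\<^esub> C) ` carrier (quot Q R)"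
    by (auto simp: ideal_gen_def)
  also have "\<dots> = (\<lambda>c. R `` {x \<otimes> c}) ` carrier Q"
    using assms by (simp add: carrier_quot image_image mult_class)
  finally have "R `` {y} \<in> pideal (quot Q R) (R `` {x}) \<longleftrightarrow> (\<exists>c\<in>carrier Q. R `` {y} = R `` {x \<otimes> c})"
    by auto
  also have "\<dots> \<longleftrightarrow> (\<exists>c\<in>carrier Q. (x \<otimes> c, y) \<in> R)"
    using assms by (metis class_eq_iff m_closed)
  finally show ?thesis .
qed

lemma green_le_quot_iff:
  assumes x: "x \<in> carrier Q" and y: "y \<in> carrier Q"
  shows "green_le (quot Q R) (R `` {x}) (R `` {y}) \<longleftrightarrow> (\<exists>c\<in>carrier Q. (x \<otimes> c, y) \<in> R)"
proof
  assume "green_le (quot Q R) (R `` {x}) (R `` {y})"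
  moreover have "R `` {y} \<in> pideal (quot Q R) (R `` {y})"
    using y R_refl by (auto simp: in_pideal_quot_iff intro!: bexI[of _ \<one>])
  ultimately show "\<exists>c\<in>carrier Q. (x \<otimes> c, y) \<in> R"
    using in_pideal_quot_iff[OF x y] by (auto simp: green_le_def)
next
  assume "\<exists>c\<in>carrier Q. (x \<otimes> c, y) \<in> R"
  then obtain c where c: "c \<in> carrier Q" "(x \<otimes> c, y) \<in> R" by blast
  have "R `` {y} \<otimes>\<^bsub>quot Q R\<^esub> R `` {d} \<in> pideal (quot Q R) (R `` {x})" if d: "d \<in> carrier Q" for d
  proof -
    have "(x \<otimes> (c \<otimes> d), y \<otimes> d) \<in> R"
      using R_mult[OF c(2) d] x c(1) d by (simp add: m_assoc)
    then show ?thesis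
      using x y d c(1) by (auto simp: mult_class in_pideal_quot_iff)
  qed
  then show "green_le (quot Q R) (R `` {x}) (R `` {y})"
    by (auto simp: green_le_def ideal_gen_def[of _ "{R `` {y}}"] carrier_quot)
qed

lemma is_nil_quot_iff:
  "x \<in> carrier Q \<Longrightarrow> is_nil (quot Q R) (R `` {x}) \<longleftrightarrow> (\<forall>c\<in>carrier Q. (x \<otimes> c, x) \<in> R)"
  by (auto simp: is_nil_def carrier_quot mult_class class_eq_iff)

lemma cancellative_quot_iff:
  "f \<in> carrier Q \<Longrightarrow> cancellative (quot Q R) (R `` {f}) \<longleftrightarrow>
     (\<forall>a\<in>carrier Q. \<forall>b\<in>carrier Q. (a \<otimes> f, b \<otimes> f) \<in> R \<longrightarrow> (a, b) \<in> R)"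
  by (auto simp: cancellative_def carrier_quot mult_class class_eq_iff)

lemma nilpotent_quot_iff:
  "x \<in> carrier Q \<Longrightarrow> nilpotent (quot Q R) (R `` {x}) \<longleftrightarrow>
     (\<exists>n::nat. n > 0 \<and> (\<forall>c\<in>carrier Q. (x [^] n \<otimes> c, x [^] n) \<in> R))"
  by (auto simp: nilpotent_def pow_class is_nil_quot_iff carrier_quot)

text \<open>Comparing \<open>q\<close> with itself is no constraint, so maximality reduces to one
  implication: if \<open>q\<close> divides \<open>w\<close> modulo \<open>R\<close>, then
  \<open>w\<close> divides \<open>q\<close>.\<close>

lemma aide_iff:
  assumes "q \<in> carrier Q" "w \<in> carrier Q" "p \<in> carrier Q"
  shows "aide Q R q w p \<longleftrightarrow> (w, q) \<notin> R \<and> (w \<otimes> p, q \<otimes> p) \<in> R \<and>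
     ((\<exists>c\<in>carrier Q. (q \<otimes> c, w) \<in> R) \<longrightarrow> (\<exists>c\<in>carrier Q. (w \<otimes> c, q) \<in> R))"
  using assms unfolding aide_def green_maximal_in_def
  by (auto simp: mult_class class_eq_iff green_le_quot_iff)

end

section \<open>Primary congruences\<close>

text \<open>The counterpart of the socle of a module over a local ring, with \<open>N\<close> as
  zero and \<open>P\<close> as the maximal ideal; zero itself is left out.\<close>

definition socle :: "('a, 'm) monoid_scheme \<Rightarrow> 'a set \<Rightarrow> 'a set \<Rightarrow> 'a set" where
  "socle Q P N = {x \<in> carrier Q - N. \<forall>p\<in>P. x \<otimes>\<^bsub>Q\<^esub> p \<in> N}"

text \<open>
  \<open>N\<close> is the nil class, except that \<open>N = {}\<close> is forced when \<open>P = {}\<close>: then \<open>Q/R\<close> is cancellative,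
  and its element must not count as nil even if \<open>Q/R\<close> is trivial.
\<close>

locale primary_congruence = monoid_congruence Q R for Q (structure) and R +
  fixes P N :: "'a set"
  assumes prime: "prime_ideal Q P"
    and N_ideal: "monoid_ideal Q N"
    and N_class: "x \<in> N \<Longrightarrow> R `` {x} = N"
    and one_not_N: "\<one> \<notin> N"
    and P_nilpotent: "p \<in> P \<Longrightarrow> \<exists>n::nat. p [^] n \<in> N"
    and cancel: "\<lbrakk>a \<in> carrier Q; b \<in> carrier Q; f \<in> carrier Q - P; (a \<otimes> f, b \<otimes> f) \<in> R\<rbrakk>
      \<Longrightarrow> (a, b) \<in> R"
begin

lemma N_subset: "N \<subseteq> carrier Q"
  using N_ideal by (simp add: monoid_ideal_def)

lemma N_mult: "x \<in> N \<Longrightarrow> c \<in> carrier Q \<Longrightarrow> x \<otimes> c \<in> N"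
  using N_ideal by (simp add: monoid_ideal_def)

lemma N_mult_left: "x \<in> N \<Longrightarrow> c \<in> carrier Q \<Longrightarrow> c \<otimes> x \<in> N"
  using N_mult[of x c] N_subset by (auto simp: m_comm)

lemma N_related: "x \<in> N \<Longrightarrow> y \<in> N \<Longrightarrow> (x, y) \<in> R"
  using N_class by blast

lemma N_saturated: "(x, y) \<in> R \<Longrightarrow> x \<in> N \<longleftrightarrow> y \<in> N"
  using N_class[of x] N_class[of y] R_sym by blast

lemma P_subset: "P \<subseteq> carrier Q"
  using prime by (simp add: prime_ideal_def monoid_ideal_def)

lemma P_mult: "p \<in> P \<Longrightarrow> c \<in> carrier Q \<Longrightarrow> p \<otimes> c \<in> P"
  using prime by (simp add: prime_ideal_def monoid_ideal_def)

lemma one_not_P: "\<one> \<in> carrier Q - P"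
  using prime by (auto simp: prime_ideal_def submonoid_def)

lemma compl_P_mult: "f \<in> carrier Q - P \<Longrightarrow> g \<in> carrier Q - P \<Longrightarrow> f \<otimes> g \<in> carrier Q - P"
  using prime unfolding prime_ideal_def submonoid_def by blast

lemma N_nonempty: "P \<noteq> {} \<Longrightarrow> N \<noteq> {}"
  using P_nilpotent by blast

text \<open>If \<open>x \<otimes> f\<close> lies in \<open>N\<close>, so does
  \<open>x \<otimes> f \<otimes> f\<close>. The two are then related, and cancelling
  \<open>f\<close> relates \<open>x \<otimes> f\<close> to \<open>x\<close>.\<close>

lemma mult_unit_in_N_iff:
  assumes x: "x \<in> carrier Q" and f: "f \<in> carrier Q - P"
  shows "x \<otimes> f \<in> N \<longleftrightarrow> x \<in> N"
proof
  assume xf: "x \<otimes> f \<in> N"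
  then have "x \<otimes> f \<otimes> f \<in> N" using f N_mult by blast
  then have "(x \<otimes> f, x) \<in> R" using cancel[of "x \<otimes> f" x f] N_related xf x f by blast
  then show "x \<in> N" using N_saturated xf by blast
qed (use f N_mult in blast)

text \<open>A relation would pass to powers. Some power of \<open>p\<close> lies in
  \<open>N\<close>, hence so would the same power of \<open>f\<close>, and
  \<open>mult_unit_in_N_iff\<close> would put \<open>\<one>\<close> in \<open>N\<close>.\<close>

lemma P_not_related_compl:
  assumes p: "p \<in> P" and f: "f \<in> carrier Q - P"
  shows "(p, f) \<notin> R"
proof
  assume r: "(p, f) \<in> R"
  have pQ: "p \<in> carrier Q" using p P_subset by blast
  have "(p [^] n, f [^] n) \<in> R \<and> f [^] n \<in> carrier Q - P" for n :: nat
  proof (induction n)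
    case 0 show ?case using one_not_P R_refl by simp
  next
    case (Suc n)
    have "(p [^] n \<otimes> p, f [^] n \<otimes> p) \<in> R" using R_mult Suc pQ by blast
    also have "(f [^] n \<otimes> p, f [^] n \<otimes> f) \<in> R" using R_mult_left[OF r] Suc by blast
    finally show ?case using compl_P_mult[OF _ f] Suc by simp
  qed
  moreover obtain n :: nat where "p [^] n \<in> N" using P_nilpotent[OF p] by blast
  ultimately have "f [^] n \<in> N" "f [^] n \<in> carrier Q - P" using N_saturated by blast+
  then show False using mult_unit_in_N_iff[of \<one> "f [^] n"] one_not_N by auto
qed

text \<open>Iterating relates \<open>x\<close> to \<open>x \<otimes> p [^] n\<close> for every
  \<open>n\<close>, and some power of \<open>p\<close> lies in \<open>N\<close>. Outside
  \<open>N\<close> this excludes cycles of divisibility through \<open>P\<close>.\<close>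

lemma absorbed_in_N:
  assumes x: "x \<in> carrier Q" and p: "p \<in> P" and r: "(x \<otimes> p, x) \<in> R"
  shows "x \<in> N"
proof -
  have pQ: "p \<in> carrier Q" using p P_subset by blast
  have "(x \<otimes> p [^] n, x) \<in> R" for n :: nat
  proof (induction n)
    case 0 show ?case using x R_refl by simp
  next
    case (Suc n)
    have "(x \<otimes> p [^] n \<otimes> p, x \<otimes> p) \<in> R" using R_mult[OF Suc pQ] .
    also note r
    finally show ?case using x pQ by (simp add: m_assoc)
  qed
  moreover obtain n :: nat where "p [^] n \<in> N" using P_nilpotent[OF p] by blast
  ultimately show ?thesis using N_mult_left[OF _ x] N_saturated by blast
qed

lemma socle_saturated:
  assumes "(x, y) \<in> R" "x \<in> socle Q P N"
  shows "y \<in> socle Q P N"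
proof -
  have "y \<otimes> p \<in> N" if "p \<in> P" for p
    using R_mult[OF assms(1), of p] N_saturated assms(2) that P_subset by (auto simp: socle_def)
  moreover have "y \<notin> N" "y \<in> carrier Q"
    using assms N_saturated R_closed by (auto simp: socle_def)
  ultimately show ?thesis by (simp add: socle_def)
qed

lemma socle_mult_unit_iff:
  assumes x: "x \<in> carrier Q" and f: "f \<in> carrier Q - P"
  shows "x \<otimes> f \<in> socle Q P N \<longleftrightarrow> x \<in> socle Q P N"
proof -
  have "x \<otimes> f \<otimes> p \<in> N \<longleftrightarrow> x \<otimes> p \<in> N" if "p \<in> P" for p
  proof -
    have p: "p \<in> carrier Q" using that P_subset by blast
    then have "x \<otimes> f \<otimes> p = x \<otimes> p \<otimes> f" using x f by (simp add: m_ac)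
    then show ?thesis using mult_unit_in_N_iff[of "x \<otimes> p" f] x f p by simp
  qed
  then show ?thesis using mult_unit_in_N_iff[OF x f] x f by (auto simp: socle_def)
qed

lemma is_nil_quot_iff_N:
  assumes "P \<noteq> {}" "x \<in> carrier Q"
  shows "is_nil (quot Q R) (R `` {x}) \<longleftrightarrow> x \<in> N"
proof -
  obtain z where z: "z \<in> N" using N_nonempty[OF assms(1)] by blast
  then have "z \<in> carrier Q" using N_subset by blast
  then show ?thesis
    using is_nil_quot_iff[OF assms(2)] N_mult_left[OF z assms(2)] N_mult[of x] N_related N_saturated
    by blast
qed

text \<open>Every element cancels here, so an \<open>x\<close> in \<open>N\<close>, written as
  \<open>\<one> \<otimes> x\<close>, would put \<open>\<one>\<close> in \<open>N\<close>.\<close>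

lemma N_empty:
  assumes "P = {}"
  shows "N = {}"
proof -
  have "x \<notin> N" if "x \<in> carrier Q" for x
    using mult_unit_in_N_iff[of \<one> x] one_not_N assms that by simp
  then show ?thesis using N_subset by blast
qed

section \<open>Key witnesses and cogenerators\<close>

text \<open>Every \<open>q\<close> divides a nil \<open>w\<close> modulo \<open>R\<close>, so
  maximality of an aide \<open>q\<close> makes \<open>w\<close> divide \<open>q\<close>. Then
  \<open>q\<close> is nil as well and related to \<open>w\<close>, which an aide must not
  be.\<close>

lemma key_witness_not_in_N: "key_witness Q P R w \<Longrightarrow> w \<in> carrier Q - N"
proof (rule ccontr)
  assume k: "key_witness Q P R w" and "w \<notin> carrier Q - N"
  then have w: "w \<in> carrier Q" "w \<in> N" by (auto simp: key_witness_def)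
  \<comment> \<open>For empty \<open>P\<close> a key aide carries no information, but then
    \<open>N\<close> is empty too.\<close>
  have "P \<noteq> {}" using N_empty w by blast
  then obtain p where p: "p \<in> P" by blast
  have "monoid_ideal Q P" using prime by (simp add: prime_ideal_def)
  then obtain q where q: "q \<in> carrier Q" "aide Q R q w p"
    using k p key_aide_iff[OF comm_monoid_axioms cong _ _ w(1)] by (auto simp: key_witness_def)
  have "(q \<otimes> w, w) \<in> R" using N_related N_mult_left w q(1) by blast
  then obtain d where "d \<in> carrier Q" "(w \<otimes> d, q) \<in> R" "(w, q) \<notin> R"
    using q p w P_subset aide_iff[of q w p] by blast
  then show False using N_mult[OF w(2)] N_saturated N_related w by blast
qed

text \<open>For nonempty \<open>P\<close>, any nil element is a key aide for a socle element. For
  empty \<open>P\<close>, both sides hold for exactly the elements of \<open>carrier Q\<close>,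
  since \<open>key_aide\<close> is then vacuous and \<open>N\<close> empty.\<close>

lemma cogenerator_iff: "cogenerator Q P R w \<longleftrightarrow> w \<in> socle Q P N"
proof (cases "P = {}")
  case True
  have "key_aide Q P R \<one> w"
    using True unfolding key_aide_def by (intro exI[of _ "{}"]) (simp add: ideal_gen_def)
  then show ?thesis
    using True N_empty by (auto simp: cogenerator_def key_witness_def socle_def)
next
  case False
  then obtain z where z: "z \<in> N" using N_nonempty by blast
  then have zQ: "z \<in> carrier Q" using N_subset by blast
  have key: "key_aide Q P R q w \<longleftrightarrow> (\<forall>p\<in>P. aide Q R q w p)"
    if "q \<in> carrier Q" "w \<in> carrier Q" for q
    using key_aide_iff[OF comm_monoid_axioms cong _ that] prime by (simp add: prime_ideal_def)
  show ?thesis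
  proof
    assume c: "cogenerator Q P R w"
    then have "w \<in> carrier Q - N"
      using key_witness_not_in_N by (simp add: cogenerator_def)
    moreover have "w \<otimes> p \<in> N" if "p \<in> P" for p
      using c that is_nil_quot_iff_N[OF False, of "w \<otimes> p"] P_subset
      by (auto simp: cogenerator_def key_witness_def)
    ultimately show "w \<in> socle Q P N" by (simp add: socle_def)
  next
    assume s: "w \<in> socle Q P N"
    then have w: "w \<in> carrier Q" "w \<notin> N" by (auto simp: socle_def)
    \<comment> \<open>All multiples of \<open>z\<close> are nil and so never related to
      \<open>w\<close>, which makes the maximality condition vacuous.\<close>
    have "aide Q R z w p" if p: "p \<in> P" for p
    proof -
      have pQ: "p \<in> carrier Q" using p P_subset by blast
      have "w \<otimes> p \<in> N" using s p by (simp add: socle_def)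
      then show ?thesis
        unfolding aide_iff[OF zQ w(1) pQ]
        using N_related N_mult[OF z] N_saturated z w pQ by blast
    qed
    then have "key_witness Q P R w"
      using key zQ w by (auto simp: key_witness_def)
    then show "cogenerator Q P R w"
      using s is_nil_quot_iff_N[OF False] w P_subset by (auto simp: cogenerator_def socle_def)
  qed
qed

text \<open>
  Choosing \<open>m\<close> with maximal annihilator \<open>{(a, b). (a + x + m, b + x + m) \<in> R}\<close> among the non-nil
  multiples of \<open>x\<close> replaces the use of a bound on the nilpotency degree of \<open>P\<close>.
\<close>

lemma exists_socle_multiple:
  assumes noeth: "noetherian_monoid Q" and x: "x \<in> carrier Q - N"
  shows "\<exists>m\<in>carrier Q. x \<otimes> m \<in> socle Q P N"
proof -
  define A where "A m = {(a, b). a \<in> carrier Q \<and> b \<in> carrier Q \<and>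
      (a \<otimes> (x \<otimes> m), b \<otimes> (x \<otimes> m)) \<in> R}" for m
  let ?M = "{m \<in> carrier Q. x \<otimes> m \<notin> N}"
  have cong_A: "congruence Q (A m)" if m: "m \<in> carrier Q" for m
    unfolding congruence_def
  proof (intro conjI allI impI equivI)
    show "A m \<subseteq> carrier Q \<times> carrier Q" by (auto simp: A_def)
    show "refl_on (carrier Q) (A m)" using R_refl x m by (auto simp: A_def intro!: refl_onI)
    show "sym (A m)" using R_sym by (auto simp: A_def intro!: symI)
    show "trans (A m)" using R_trans unfolding A_def by (intro transI) blast
    fix a b c assume "(a, b) \<in> A m \<and> c \<in> carrier Q"
    then show "(a \<otimes> c, b \<otimes> c) \<in> A m"
      using R_mult[of "a \<otimes> (x \<otimes> m)" "b \<otimes> (x \<otimes> m)" c] x m by (auto simp: A_def m_ac)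
  qed
  have "\<one> \<in> ?M" using x by simp
  then have "\<exists>C\<in>A ` ?M. \<forall>D\<in>A ` ?M. C \<subseteq> D \<longrightarrow> D = C"
    using noetherian_maximal[OF noeth, of "A ` ?M"] cong_A by blast
  then obtain m where "m \<in> ?M" and max': "\<forall>D\<in>A ` ?M. A m \<subseteq> D \<longrightarrow> D = A m"
    by (elim bexE imageE) simp
  then have m: "m \<in> carrier Q" "x \<otimes> m \<notin> N" by simp_all
  have max: "A k = A m" if "k \<in> ?M" "A m \<subseteq> A k" for k
    using max'[rule_format, OF imageI[OF that(1)] that(2)] .
  have "x \<otimes> m \<otimes> p \<in> N" if p: "p \<in> P" for p
  proof (rule ccontr)
    assume np: "x \<otimes> m \<otimes> p \<notin> N"
    have pQ: "p \<in> carrier Q" using p P_subset by blast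
    have eq: "a \<otimes> (x \<otimes> (m \<otimes> p)) = a \<otimes> (x \<otimes> m) \<otimes> p" if "a \<in> carrier Q" for a
      using that x m pQ by (simp add: m_assoc)
    have "A m \<subseteq> A (m \<otimes> p)"
    proof (rule subrelI)
      fix a b assume "(a, b) \<in> A m"
      then show "(a, b) \<in> A (m \<otimes> p)"
        using R_mult[of "a \<otimes> (x \<otimes> m)" "b \<otimes> (x \<otimes> m)" p] pQ by (simp add: A_def eq)
    qed
    moreover have "m \<otimes> p \<in> ?M" using np x m pQ by (simp add: m_assoc)
    ultimately have A_eq: "A (m \<otimes> p) = A m" using max by blast
    \<comment> \<open>With \<open>j\<close> one less than the least exponent \<open>k\<close>, both
      \<open>p [^] j\<close> and \<open>p [^] k\<close> send
      \<open>x \<otimes> m \<otimes> p\<close> into \<open>N\<close>, but only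
      \<open>p [^] k\<close> sends \<open>x \<otimes> m\<close> there. So this pair distinguishes
      \<open>A (m \<otimes> p)\<close> from \<open>A m\<close>.\<close>
    define k where "k = (LEAST k::nat. p [^] k \<otimes> (x \<otimes> m) \<in> N)"
    obtain n :: nat where "p [^] n \<in> N" using P_nilpotent[OF p] by blast
    then have "p [^] n \<otimes> (x \<otimes> m) \<in> N" using N_mult x m by blast
    then have k: "p [^] k \<otimes> (x \<otimes> m) \<in> N" unfolding k_def by (rule LeastI)
    then have "k \<noteq> 0" using m x by (intro notI) simp
    then obtain j where j: "k = Suc j" using not0_implies_Suc by blast
    then have nj: "p [^] j \<otimes> (x \<otimes> m) \<notin> N"
      using not_less_Least[of j "\<lambda>k. p [^] k \<otimes> (x \<otimes> m) \<in> N"] unfolding k_def by simp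
    have "p [^] j \<otimes> (x \<otimes> m) \<otimes> p \<in> N" using k x m pQ by (simp add: j m_ac)
    moreover have "p [^] k \<otimes> (x \<otimes> m) \<otimes> p \<in> N" using k pQ N_mult by blast
    ultimately have "(p [^] j, p [^] k) \<in> A (m \<otimes> p)"
      using N_related pQ by (simp add: A_def eq)
    then show False using k nj N_saturated unfolding A_eq by (auto simp: A_def)
  qed
  then show ?thesis using m x by (auto simp: socle_def)
qed

end

section \<open>Congruences whose socle is a single orbit of units\<close>

lemma soccular_closure_eq_Union: "soccular_closure Q P R = (\<Union>i. iter_collapse Q P i R)"
proof -
  have "(\<Union>i. iter_collapse Q P i R) = (\<Union>i\<in>insert 0 {1..}. iter_collapse Q P i R)"
    by (rule arg_cong[of _ _ "\<lambda>I. \<Union>i\<in>I. iter_collapse Q P i R"]) auto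
  then show ?thesis by (simp add: soccular_closure_def iter_collapse_def)
qed

text \<open>A form of coprincipality that collapses keep with the same \<open>N\<close>, and that
  coprincipal components keep with \<open>non_divisors\<close> as the new \<open>N\<close>. The
  axiom \<open>socle_orbit\<close> also says that the socle is nonempty.\<close>

locale soccular_congruence = primary_congruence Q R P N
  for Q (structure) and R P N +
  assumes unit: "f \<in> carrier Q - P \<Longrightarrow> \<exists>g\<in>carrier Q - P. (f \<otimes> g, \<one>) \<in> R"
    and free: "\<lbrakk>x \<in> carrier Q - N; f \<in> carrier Q - P; g \<in> carrier Q - P; (x \<otimes> f, x \<otimes> g) \<in> R\<rbrakk>
      \<Longrightarrow> (f, g) \<in> R"
    and socle_orbit: "\<exists>s\<in>socle Q P N. \<forall>t\<in>socle Q P N. \<exists>f\<in>carrier Q - P. (s \<otimes> f, t) \<in> R"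
begin

text \<open>Both elements are unit multiples of a base point \<open>r\<close>: invert the unit
  leading to \<open>s\<close>, then apply the one leading to \<open>t\<close>.\<close>

lemma socle_transitive:
  assumes s: "s \<in> socle Q P N" and t: "t \<in> socle Q P N"
  shows "\<exists>f\<in>carrier Q. (s \<otimes> f, t) \<in> R"
proof -
  obtain r where "r \<in> socle Q P N"
    and orbit: "\<forall>t\<in>socle Q P N. \<exists>f\<in>carrier Q - P. (r \<otimes> f, t) \<in> R"
    using socle_orbit by blast
  then have r: "r \<in> carrier Q" by (simp add: socle_def)
  obtain f where f: "f \<in> carrier Q - P" "(r \<otimes> f, s) \<in> R" using orbit s by blast
  obtain g where g: "g \<in> carrier Q" "(r \<otimes> g, t) \<in> R" using orbit t by blast
  obtain h where h: "h \<in> carrier Q" "(f \<otimes> h, \<one>) \<in> R" using unit[OF f(1)] by blast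
  have "(s \<otimes> (h \<otimes> g), r \<otimes> g \<otimes> (f \<otimes> h)) \<in> R"
    using R_sym[OF R_mult[OF f(2), of "h \<otimes> g"]] r f(1) g(1) h(1) by (simp add: m_ac)
  also have "(r \<otimes> g \<otimes> (f \<otimes> h), r \<otimes> g) \<in> R"
    using R_mult_left[OF h(2), of "r \<otimes> g"] r g(1) by simp
  also note g(2)
  finally show ?thesis using h(1) g(1) by blast
qed

text \<open>A factor in \<open>P\<close> sends \<open>s\<close> into \<open>N\<close>, and a factor
  off \<open>P\<close> keeps it in the socle. The ideal that a collapse avoids is thus the same for
  every cogenerator, which yields \<open>collapse_eq\<close>.\<close>

lemma in_pideal_socle_iff:
  assumes s: "s \<in> socle Q P N" and a: "a \<in> carrier Q"
  shows "R `` {a} \<in> pideal (quot Q R) (R `` {s}) \<longleftrightarrow> a \<in> socle Q P N \<union> N"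
proof -
  have sQ: "s \<in> carrier Q" using s by (simp add: socle_def)
  show ?thesis unfolding in_pideal_quot_iff[OF sQ a]
  proof
    assume "\<exists>c\<in>carrier Q. (s \<otimes> c, a) \<in> R"
    then obtain c where c: "c \<in> carrier Q" "(s \<otimes> c, a) \<in> R" by blast
    show "a \<in> socle Q P N \<union> N"
    proof (cases "c \<in> P")
      case True
      then show ?thesis using s c N_saturated by (auto simp: socle_def)
    next
      case False
      then show ?thesis using s c socle_mult_unit_iff[OF sQ, of c] socle_saturated by blast
    qed
  next
    assume "a \<in> socle Q P N \<union> N"
    then show "\<exists>c\<in>carrier Q. (s \<otimes> c, a) \<in> R"
      using socle_transitive[OF s] N_mult_left[OF _ sQ] N_related a by blast
  qed
qed

lemma collapse_eq:
  "soccular_collapse Q P R = R \<union> {(a, b). a \<in> carrier Q - (socle Q P N \<union> N) \<and>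
     b \<in> carrier Q - (socle Q P N \<union> N) \<and> (\<forall>p\<in>P. (a \<otimes> p, b \<otimes> p) \<in> R)}"
proof -
  obtain s where s: "s \<in> socle Q P N" using socle_orbit by blast
  have "(\<exists>w. cogenerator Q P R w \<and> R `` {a} \<notin> pideal (quot Q R) (R `` {w}) \<and>
               R `` {b} \<notin> pideal (quot Q R) (R `` {w})) \<longleftrightarrow>
      a \<notin> socle Q P N \<union> N \<and> b \<notin> socle Q P N \<union> N"
    if "a \<in> carrier Q" "b \<in> carrier Q" for a b
    unfolding cogenerator_iff using in_pideal_socle_iff that s by blast
  then show ?thesis unfolding soccular_collapse_def by blast
qed

text \<open>The collapse leaves the class \<open>N\<close> alone, hence also the socle, which is
  defined without \<open>R\<close>. Freeness at an \<open>x\<close> off the socle is tested at a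
  non-nil multiple \<open>x \<otimes> p\<close>, where the collapse gives back a relation in
  \<open>R\<close>; on the socle the collapse relates nothing new.\<close>

lemma soccular_congruence_collapse: "soccular_congruence Q (soccular_collapse Q P R) P N"
proof -
  let ?W = "socle Q P N \<union> N" and ?C = "soccular_collapse Q P R"
  have sat: "a \<in> ?W \<longleftrightarrow> b \<in> ?W" if "(a, b) \<in> R" for a b
    using that socle_saturated N_saturated R_sym by blast
  have sub: "R \<subseteq> ?C" by (simp add: soccular_collapse_def)
  have P_step: "(a \<otimes> p, b \<otimes> p) \<in> R" if "(a, b) \<in> ?C" "p \<in> P" for a b p
    using that R_mult P_subset unfolding collapse_eq by blast
  have iff: "(a, b) \<in> ?C \<longleftrightarrow> (a, b) \<in> R \<or> a \<in> carrier Q - ?W \<and> b \<in> carrier Q - ?W \<and>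
     (\<forall>p\<in>P. (a \<otimes> p, b \<otimes> p) \<in> R)" for a b
    unfolding collapse_eq by blast
  have "congruence Q ?C" unfolding congruence_def
    proof (intro conjI allI impI equivI)
      show "?C \<subseteq> carrier Q \<times> carrier Q" using R_closed by (auto simp: iff)
      show "refl_on (carrier Q) ?C" using R_refl sub by (auto intro!: refl_onI)
      show "sym ?C" using R_sym by (auto simp: iff intro!: symI)
      show "trans ?C"
      proof (rule transI)
        fix a b c assume ab: "(a, b) \<in> ?C" and bc: "(b, c) \<in> ?C"
        have "(a \<otimes> p, c \<otimes> p) \<in> R" if "p \<in> P" for p
          using P_step[OF ab that] P_step[OF bc that] R_trans by blast
        then show "(a, c) \<in> ?C"
          using ab bc sat R_trans R_closed unfolding iff by blast
      qed
      fix a b c assume as: "(a, b) \<in> ?C \<and> c \<in> carrier Q"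
      show "(a \<otimes> c, b \<otimes> c) \<in> ?C"
      proof (cases "(a, b) \<in> R \<or> c \<in> P")
        case True
        then show ?thesis using as R_mult P_step sub by blast
      next
        case False
        then have ab: "a \<in> carrier Q - ?W" "b \<in> carrier Q - ?W" "\<forall>p\<in>P. (a \<otimes> p, b \<otimes> p) \<in> R"
          and c: "c \<in> carrier Q - P" using as by (auto simp: iff)
        have "(a \<otimes> c \<otimes> p, b \<otimes> c \<otimes> p) \<in> R" if "p \<in> P" for p
          using R_mult[of "a \<otimes> p" "b \<otimes> p" c] ab c that P_subset by (auto simp: m_ac subset_iff)
        moreover have "a \<otimes> c \<notin> ?W" "b \<otimes> c \<notin> ?W"
          using ab c socle_mult_unit_iff mult_unit_in_N_iff by auto
        ultimately show ?thesis using ab(1,2) c by (simp add: iff)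
      qed
    qed
  then interpret C: monoid_congruence Q ?C by unfold_locales
  show ?thesis
  proof
    show "prime_ideal Q P" "monoid_ideal Q N" by (fact prime N_ideal)+
    show "?C `` {x} = N" if "x \<in> N" for x
      using N_class[OF that] that by (auto simp: iff)
    show "\<exists>n::nat. p [^] n \<in> N" if "p \<in> P" for p by (rule P_nilpotent[OF that])
    show "\<one> \<notin> N" by (rule one_not_N)
    show u: "\<exists>g\<in>carrier Q - P. (f \<otimes> g, \<one>) \<in> ?C" if "f \<in> carrier Q - P" for f
      using unit[OF that] sub by blast
    show "(a, b) \<in> ?C"
      if "a \<in> carrier Q" "b \<in> carrier Q" "f \<in> carrier Q - P" "(a \<otimes> f, b \<otimes> f) \<in> ?C" for a b f
      using u[OF that(3)] C.cancel_unit that by blast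
    show "\<exists>s\<in>socle Q P N. \<forall>t\<in>socle Q P N. \<exists>f\<in>carrier Q - P. (s \<otimes> f, t) \<in> ?C"
      using socle_orbit sub by blast
    fix x f g
    assume x: "x \<in> carrier Q - N" and f: "f \<in> carrier Q - P" and g: "g \<in> carrier Q - P"
      and r: "(x \<otimes> f, x \<otimes> g) \<in> ?C"
    show "(f, g) \<in> ?C"
    proof (cases "(x \<otimes> f, x \<otimes> g) \<in> R")
      case True
      then show ?thesis using free[OF x f g] sub by blast
    next
      case False
      then have "x \<notin> socle Q P N"
        using r x f socle_mult_unit_iff[of x f] by (auto simp: iff)
      then obtain p where p: "p \<in> P" "x \<otimes> p \<notin> N" using x by (auto simp: socle_def)
      have pQ: "p \<in> carrier Q" using p P_subset by blast
      have "(x \<otimes> p \<otimes> f, x \<otimes> p \<otimes> g) \<in> R"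
        using P_step[OF r p(1)] x f g pQ by (simp add: m_ac)
      then show ?thesis using free[of "x \<otimes> p" f g] p(2) x f g pQ sub by blast
    qed
  qed
qed

lemma soccular_congruence_iter_collapse: "soccular_congruence Q (iter_collapse Q P i R) P N"
proof (induction i)
  case 0
  show ?case by (simp add: iter_collapse_def soccular_congruence_axioms)
next
  case (Suc i)
  show ?case
    using soccular_congruence.soccular_congruence_collapse[OF Suc.IH] by (simp add: iter_collapse_def)
qed

text \<open>All collapses share the set \<open>N\<close>, so none joins an element of
  \<open>N\<close> to one outside. This invariant later keeps pairs apart in soccular
  components.\<close>

lemma closure_N_saturated:
  assumes "(a, b) \<in> soccular_closure Q P R"
  shows "a \<in> N \<longleftrightarrow> b \<in> N"
proof -
  obtain i where "(a, b) \<in> iter_collapse Q P i R"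
    using assms unfolding soccular_closure_eq_Union by blast
  then show ?thesis
    using primary_congruence.N_saturated[OF soccular_congruence.axioms(1)]
      soccular_congruence_iter_collapse by metis
qed

section \<open>Pairs joined by a single collapse\<close>

text \<open>The key aide is \<open>b\<close>: the collapse supplies agreement with \<open>a\<close>
  after multiplication by \<open>P\<close>, and \<open>nd\<close> makes the maximality condition
  vacuous.\<close>

lemma collapse_key_witness:
  assumes c: "(a, b) \<in> soccular_collapse Q P R" and n: "(a, b) \<notin> R"
    and nd: "\<not> (\<exists>c\<in>carrier Q. (b \<otimes> c, a) \<in> R)"
  shows "key_witness Q P R a"
proof -
  have ab: "a \<in> carrier Q" "b \<in> carrier Q" and p: "\<forall>p\<in>P. (a \<otimes> p, b \<otimes> p) \<in> R"
    using c n by (auto simp: collapse_eq)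
  have "aide Q R b a p" if "p \<in> P" for p
    using that p n nd ab P_subset aide_iff[of b a p] by blast
  moreover have "monoid_ideal Q P" using prime by (simp add: prime_ideal_def)
  ultimately have "key_aide Q P R b a"
    using key_aide_iff[OF comm_monoid_axioms cong _ ab(2) ab(1)] by blast
  then show ?thesis using ab by (auto simp: key_witness_def)
qed

text \<open>If \<open>x \<otimes> y\<close> were in \<open>P\<close>, it would absorb
  \<open>a\<close> into \<open>N\<close>; so \<open>x\<close> lies off \<open>P\<close>. For some
  \<open>p\<close> in \<open>P\<close>, \<open>a \<otimes> p\<close> is non-nil and fixed by
  \<open>x\<close> modulo \<open>R\<close>. Freeness gives \<open>(x, \<one>) \<in> R\<close>, and
  \<open>a\<close> is related to \<open>b\<close> already.\<close>

lemma collapse_not_mutually_dividing: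
  assumes c: "(a, b) \<in> soccular_collapse Q P R" and n: "(a, b) \<notin> R"
    and x: "x \<in> carrier Q" "(a \<otimes> x, b) \<in> R" and y: "y \<in> carrier Q" "(b \<otimes> y, a) \<in> R"
  shows False
proof -
  have a: "a \<in> carrier Q - N" "a \<notin> socle Q P N" and b: "b \<in> carrier Q"
    and ap: "\<forall>p\<in>P. (a \<otimes> p, b \<otimes> p) \<in> R"
    using c n by (auto simp: collapse_eq)
  have "(a \<otimes> (x \<otimes> y), a) \<in> R"
    using R_trans[OF R_mult[OF x(2) y(1)] y(2)] a x(1) y(1) by (simp add: m_assoc)
  then have "x \<otimes> y \<notin> P" using absorbed_in_N[of a "x \<otimes> y"] a by blast
  then have xP: "x \<in> carrier Q - P" using P_mult x y by blast
  obtain p where p: "p \<in> P" "a \<otimes> p \<notin> N" using a by (auto simp: socle_def)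
  then have pQ: "p \<in> carrier Q" using P_subset by blast
  have "(a \<otimes> p \<otimes> x, b \<otimes> p) \<in> R"
    using R_mult[OF x(2) pQ] a x(1) pQ by (simp add: m_ac)
  also have "(b \<otimes> p, a \<otimes> p) \<in> R" using ap p R_sym by blast
  finally have "(a \<otimes> p \<otimes> x, a \<otimes> p \<otimes> \<one>) \<in> R" using a pQ by simp
  then have "(x, \<one>) \<in> R" using free[of "a \<otimes> p" x \<one>] xP one_not_P p a pQ by blast
  then have "(a \<otimes> x, a) \<in> R" using R_mult_left[of x \<one> a] a by simp
  then show False using n x(2) R_sym R_trans by blast
qed

end

section \<open>Coprincipal components\<close>

text \<open>This set takes over the role of \<open>N\<close> in the coprincipal component at
  \<open>w\<close>.\<close>

definition non_divisors :: "('a, 'm) monoid_scheme \<Rightarrow> 'a rel \<Rightarrow> 'a \<Rightarrow> 'a set" where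
  "non_divisors Q R w = {a \<in> carrier Q. \<not> (\<exists>c\<in>carrier Q. (a \<otimes>\<^bsub>Q\<^esub> c, w) \<in> R)}"

context soccular_congruence
begin

section \<open>Localization along \<open>P\<close>\<close>

abbreviation "fractions \<equiv> Q \<times>\<times> Q\<lparr>carrier := carrier Q - P\<rparr>"

text \<open>The extra factor \<open>h\<close> in \<open>frac_rel\<close> drops out because elements
  off \<open>P\<close> cancel modulo \<open>R\<close>.\<close>

lemma frac_rel_iff:
  "((a, f), (b, g)) \<in> frac_rel Q P R \<longleftrightarrow>
     a \<in> carrier Q \<and> b \<in> carrier Q \<and> f \<in> carrier Q - P \<and> g \<in> carrier Q - P \<and> (a \<otimes> g, b \<otimes> f) \<in> R"
proof -
  have "(\<exists>h\<in>carrier Q - P. (a \<otimes> g \<otimes> h, b \<otimes> f \<otimes> h) \<in> R) \<longleftrightarrow> (a \<otimes> g, b \<otimes> f) \<in> R"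
    if "a \<in> carrier Q" "b \<in> carrier Q" "f \<in> carrier Q" "g \<in> carrier Q"
    using that cancel[of "a \<otimes> g" "b \<otimes> f"] one_not_P by (auto intro!: bexI[of _ \<one>])
  then show ?thesis by (auto simp: frac_rel_def)
qed

text \<open>This makes the lemmas on quotients available for the localization. Transitivity holds
  because the middle denominator \<open>g\<close> cancels.\<close>

lemma fractions_congruence: "monoid_congruence fractions (frac_rel Q P R)"
proof -
  have "submonoid (carrier Q - P) Q" using prime by (simp add: prime_ideal_def)
  then interpret S: comm_monoid "Q\<lparr>carrier := carrier Q - P\<rparr>"
    by (rule submonoid_is_comm_monoid)
  interpret F: monoid fractions
    by (rule DirProd_monoid[OF monoid_axioms S.monoid_axioms])
  interpret F: comm_monoid fractions
    by (rule F.monoid_comm_monoidI) (auto simp: m_comm)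
  show ?thesis
  proof
    show "congruence fractions (frac_rel Q P R)" unfolding congruence_def
    proof (intro conjI allI impI equivI)
      show "frac_rel Q P R \<subseteq> carrier fractions \<times> carrier fractions"
        by (auto simp: frac_rel_iff)
      show "refl_on (carrier fractions) (frac_rel Q P R)"
        using R_refl by (auto simp: frac_rel_iff intro!: refl_onI)
      show "sym (frac_rel Q P R)"
        using R_sym by (auto simp: frac_rel_iff intro!: symI)
      show "trans (frac_rel Q P R)"
      proof (rule transI, clarify)
        fix a f b g c h
        assume ab: "((a, f), (b, g)) \<in> frac_rel Q P R" and bc: "((b, g), (c, h)) \<in> frac_rel Q P R"
        then have cl: "a \<in> carrier Q" "b \<in> carrier Q" "c \<in> carrier Q"
          "f \<in> carrier Q - P" "g \<in> carrier Q - P" "h \<in> carrier Q - P" by (auto simp: frac_rel_iff)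
        have "(a \<otimes> g \<otimes> h, b \<otimes> f \<otimes> h) \<in> R" using ab cl R_mult by (auto simp: frac_rel_iff)
        moreover have "(b \<otimes> h \<otimes> f, c \<otimes> g \<otimes> f) \<in> R" using bc cl R_mult by (auto simp: frac_rel_iff)
        ultimately have "(a \<otimes> h \<otimes> g, c \<otimes> f \<otimes> g) \<in> R"
          using R_trans cl by (simp add: m_ac)
        then show "((a, f), (c, h)) \<in> frac_rel Q P R"
          using cancel[of "a \<otimes> h" "c \<otimes> f" g] cl by (simp add: frac_rel_iff)
      qed
      fix x y z assume as: "(x, y) \<in> frac_rel Q P R \<and> z \<in> carrier fractions"
      obtain a f b g c h where eqs: "x = (a, f)" "y = (b, g)" "z = (c, h)"
        by (cases x; cases y; cases z)
      have cl: "a \<in> carrier Q" "b \<in> carrier Q" "c \<in> carrier Q"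
          "f \<in> carrier Q - P" "g \<in> carrier Q - P" "h \<in> carrier Q - P"
        and r: "(a \<otimes> g, b \<otimes> f) \<in> R" using as by (auto simp: eqs frac_rel_iff)
      have "(a \<otimes> c \<otimes> (g \<otimes> h), b \<otimes> c \<otimes> (f \<otimes> h)) \<in> R"
        using R_mult[OF r, of "c \<otimes> h"] cl by (simp add: m_ac)
      then show "(x \<otimes>\<^bsub>fractions\<^esub> z, y \<otimes>\<^bsub>fractions\<^esub> z) \<in> frac_rel Q P R"
        using cl compl_P_mult by (simp add: eqs frac_rel_iff)
    qed
  qed
qed

text \<open>Elements off \<open>P\<close> are already units modulo \<open>R\<close>, so localizing
  creates no new divisors of \<open>w\<close>, and the first alternative gives the square of
  \<open>non_divisors Q R w\<close>. In the second, freeness at a multiple of \<open>w\<close>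
  forces the unit between \<open>a\<close> and \<open>b\<close> to be trivial, so that only pairs in
  \<open>R\<close> remain.\<close>

lemma coprincipal_component_eq:
  assumes w: "w \<in> carrier Q - N"
  shows "coprincipal_component Q P R w = R \<union> non_divisors Q R w \<times> non_divisors Q R w"
proof -
  interpret F: monoid_congruence fractions "frac_rel Q P R"
    by (rule fractions_congruence)
  let ?L = "loc_quot Q P R" and ?i = "loc_image Q P R"
  have i_eq: "?i a = ?i b \<longleftrightarrow> (a, b) \<in> R" if "a \<in> carrier Q" "b \<in> carrier Q" for a b
    using that one_not_P F.class_eq_iff[of "(a, \<one>)" "(b, \<one>)"]
    by (simp add: loc_image_def frac_rel_iff)
  have i_mult: "?i a \<otimes>\<^bsub>?L\<^esub> (frac_rel Q P R `` {(c, f)}) = ?i b \<longleftrightarrow> (a \<otimes> c, b \<otimes> f) \<in> R"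
    if "a \<in> carrier Q" "b \<in> carrier Q" "c \<in> carrier Q" "f \<in> carrier Q - P" for a b c f
    using that one_not_P F.mult_class[of "(a, \<one>)" "(c, f)"] F.class_eq_iff[of "(a \<otimes> c, f)" "(b, \<one>)"]
    by (simp add: loc_image_def loc_quot_def frac_rel_iff)
  have L: "X \<in> carrier ?L \<longleftrightarrow>
      (\<exists>c\<in>carrier Q. \<exists>f\<in>carrier Q - P. X = frac_rel Q P R `` {(c, f)})" for X
    using F.carrier_quot by (auto simp: loc_quot_def)
  have one_L: "\<one>\<^bsub>?L\<^esub> = frac_rel Q P R `` {(\<one>, \<one>)}"
    using F.one_quot by (simp add: loc_quot_def)
  have divides: "?i w \<in> pideal ?L (?i a) \<longleftrightarrow> (\<exists>c\<in>carrier Q. (a \<otimes> c, w) \<in> R)"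
    if a: "a \<in> carrier Q" for a
  proof
    assume "?i w \<in> pideal ?L (?i a)"
    then obtain X where X: "X \<in> carrier ?L" "?i a \<otimes>\<^bsub>?L\<^esub> X = ?i w"
      by (auto simp: ideal_gen_def)
    then obtain c f where c: "c \<in> carrier Q" and f: "f \<in> carrier Q - P"
      and r: "(a \<otimes> c, w \<otimes> f) \<in> R"
      using L i_mult a w by auto
    \<comment> \<open>The denominator \<open>f\<close> is removed by its inverse modulo
      \<open>R\<close>.\<close>
    obtain g where g: "g \<in> carrier Q" "(f \<otimes> g, \<one>) \<in> R" using unit[OF f] by blast
    have "(a \<otimes> (c \<otimes> g), w \<otimes> (f \<otimes> g)) \<in> R"
      using R_mult[OF r g(1)] a c f w g(1) by (simp add: m_assoc)
    also have "(w \<otimes> (f \<otimes> g), w) \<in> R" using R_mult_left[OF g(2), of w] w by simp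
    finally show "\<exists>c\<in>carrier Q. (a \<otimes> c, w) \<in> R" using c g(1) by blast
  next
    assume "\<exists>c\<in>carrier Q. (a \<otimes> c, w) \<in> R"
    then obtain c where c: "c \<in> carrier Q" "(a \<otimes> c, w) \<in> R" by blast
    then have "?i w = ?i a \<otimes>\<^bsub>?L\<^esub> (frac_rel Q P R `` {(c, \<one>)})"
      using i_mult[of a w c \<one>] a w one_not_P by simp
    moreover have "frac_rel Q P R `` {(c, \<one>)} \<in> carrier ?L" using L c one_not_P by blast
    ultimately show "?i w \<in> pideal ?L (?i a)" by (auto simp: ideal_gen_def)
  qed
  have unit_case: "(a, b) \<in> R"
    if a: "a \<in> carrier Q" and b: "b \<in> carrier Q" and u: "u \<in> Units ?L" "?i b = ?i a \<otimes>\<^bsub>?L\<^esub> u"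
      and X: "X \<in> carrier ?L" "?i a \<otimes>\<^bsub>?L\<^esub> X = ?i w" "?i b \<otimes>\<^bsub>?L\<^esub> X = ?i w" for a b u X
  proof -
    obtain c f where c: "c \<in> carrier Q" and f: "f \<in> carrier Q - P"
      and ac: "(a \<otimes> c, w \<otimes> f) \<in> R" and bc: "(b \<otimes> c, w \<otimes> f) \<in> R"
      using X L i_mult a b w by auto
    obtain v where v: "u \<in> carrier ?L" "v \<in> carrier ?L" "u \<otimes>\<^bsub>?L\<^esub> v = \<one>\<^bsub>?L\<^esub>"
      using u(1) by (auto simp: Units_def)
    obtain x g where x: "x \<in> carrier Q" and g: "g \<in> carrier Q - P"
      and ux: "u = frac_rel Q P R `` {(x, g)}" using v(1) L by blast
    obtain y h where y: "y \<in> carrier Q" and h: "h \<in> carrier Q - P"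
      and vy: "v = frac_rel Q P R `` {(y, h)}" using v(2) L by blast
    have "(x \<otimes> y, g \<otimes> h) \<in> R"
      using v(3) x y g h compl_P_mult[OF g h] one_not_P F.mult_class[of "(x, g)" "(y, h)"]
        F.class_eq_iff[of "(x \<otimes> y, g \<otimes> h)" "(\<one>, \<one>)"]
      unfolding ux vy one_L by (simp add: loc_quot_def frac_rel_iff)
    \<comment> \<open>The numerator of a unit lies off \<open>P\<close>: otherwise
      \<open>x \<otimes> y\<close> would be an element of \<open>P\<close> related to a product of
      denominators.\<close>
    then have xP: "x \<in> carrier Q - P"
      using P_not_related_compl[OF _ compl_P_mult[OF g h]] P_mult x y by blast
    have ax: "(a \<otimes> x, b \<otimes> g) \<in> R"
      using u(2) i_mult[OF a b x g] by (simp add: ux)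
    \<comment> \<open>Replacing \<open>a\<close> by \<open>b\<close> trades the factor
      \<open>x\<close> for \<open>g\<close>, while \<open>a \<otimes> c\<close> and
      \<open>b \<otimes> c\<close> are both related to \<open>w \<otimes> f\<close>.\<close>
    have "(w \<otimes> f \<otimes> x, a \<otimes> c \<otimes> x) \<in> R" using R_mult[OF R_sym[OF ac] x] .
    also have "(a \<otimes> c \<otimes> x, b \<otimes> c \<otimes> g) \<in> R"
      using R_mult[OF ax c] a b c x g by (simp add: m_ac)
    also have "(b \<otimes> c \<otimes> g, w \<otimes> f \<otimes> g) \<in> R" using R_mult[OF bc] g by blast
    finally have "(w \<otimes> f \<otimes> x, w \<otimes> f \<otimes> g) \<in> R" .
    then have "(x, g) \<in> R"
      using free[of "w \<otimes> f" x g] mult_unit_in_N_iff[of w f] w f xP g by simp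
    then have "(a \<otimes> g, b \<otimes> g) \<in> R"
      using R_trans[OF R_mult_left[OF R_sym a] ax] by blast
    then show ?thesis using cancel[OF a b g] by blast
  qed
  have related_case: "(\<exists>u\<in>Units ?L. ?i b = ?i a \<otimes>\<^bsub>?L\<^esub> u) \<and>
      (\<exists>X\<in>carrier ?L. ?i a \<otimes>\<^bsub>?L\<^esub> X = ?i w \<and> ?i b \<otimes>\<^bsub>?L\<^esub> X = ?i w)"
    if ab: "(a, b) \<in> R" and c: "c \<in> carrier Q" "(a \<otimes> c, w) \<in> R" for a b c
  proof (intro conjI bexI)
    have a: "a \<in> carrier Q" and b: "b \<in> carrier Q" using R_closed ab by blast+
    show "?i b = ?i a \<otimes>\<^bsub>?L\<^esub> \<one>\<^bsub>?L\<^esub>"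
      using i_mult[OF a b, of \<one> \<one>] one_not_P ab a b by (simp add: one_L)
    have "\<one>\<^bsub>?L\<^esub> \<otimes>\<^bsub>?L\<^esub> \<one>\<^bsub>?L\<^esub> = \<one>\<^bsub>?L\<^esub>"
      using F.mult_class[of "(\<one>, \<one>)" "(\<one>, \<one>)"] one_not_P unfolding one_L by (simp add: loc_quot_def)
    moreover have "\<one>\<^bsub>?L\<^esub> \<in> carrier ?L" using L one_not_P unfolding one_L by blast
    ultimately show "\<one>\<^bsub>?L\<^esub> \<in> Units ?L" by (auto simp: Units_def)
    show "frac_rel Q P R `` {(c, \<one>)} \<in> carrier ?L" using L c one_not_P by blast
    show "?i a \<otimes>\<^bsub>?L\<^esub> (frac_rel Q P R `` {(c, \<one>)}) = ?i w"
      using i_mult[of a w c \<one>] a c w one_not_P by simp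
    show "?i b \<otimes>\<^bsub>?L\<^esub> (frac_rel Q P R `` {(c, \<one>)}) = ?i w"
      using i_mult[of b w c \<one>] b c w one_not_P R_trans[OF R_mult[OF R_sym[OF ab] c(1)] c(2)] by simp
  qed
  have D_iff: "a \<in> non_divisors Q R w \<longleftrightarrow> ?i w \<notin> pideal ?L (?i a)" if "a \<in> carrier Q" for a
    using divides[OF that] that by (simp add: non_divisors_def)
  have D_closed: "a \<in> carrier Q" if "a \<in> non_divisors Q R w" for a
    using that by (simp add: non_divisors_def)
  have comp_iff: "(a, b) \<in> coprincipal_component Q P R w \<longleftrightarrow> a \<in> carrier Q \<and> b \<in> carrier Q \<and>
      (?i w \<notin> pideal ?L (?i a) \<and> ?i w \<notin> pideal ?L (?i b) \<or>
       (\<exists>u\<in>Units ?L. ?i b = ?i a \<otimes>\<^bsub>?L\<^esub> u) \<and>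
       (\<exists>X\<in>carrier ?L. ?i a \<otimes>\<^bsub>?L\<^esub> X = ?i w \<and> ?i b \<otimes>\<^bsub>?L\<^esub> X = ?i w))" for a b
    unfolding coprincipal_component_def Let_def by simp
  have "\<forall>a b. (a, b) \<in> coprincipal_component Q P R w \<longleftrightarrow>
      (a, b) \<in> R \<union> non_divisors Q R w \<times> non_divisors Q R w"
  proof (intro allI)
    fix a b
    show "(a, b) \<in> coprincipal_component Q P R w \<longleftrightarrow>
      (a, b) \<in> R \<union> non_divisors Q R w \<times> non_divisors Q R w" (is "?l \<longleftrightarrow> ?r")
    proof
      assume l: ?l
      then have ab: "a \<in> carrier Q" "b \<in> carrier Q" by (simp_all only: comp_iff)
      from l consider "?i w \<notin> pideal ?L (?i a)" "?i w \<notin> pideal ?L (?i b)"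
        | u X where "u \<in> Units ?L" "?i b = ?i a \<otimes>\<^bsub>?L\<^esub> u"
            "X \<in> carrier ?L" "?i a \<otimes>\<^bsub>?L\<^esub> X = ?i w" "?i b \<otimes>\<^bsub>?L\<^esub> X = ?i w"
        unfolding comp_iff by (elim conjE disjE bexE)
      then show ?r
      proof cases
        case 1
        then show ?thesis using D_iff ab by simp
      next
        case 2
        then show ?thesis using unit_case[OF ab] by simp
      qed
    next
      assume r: ?r
      then have ab: "a \<in> carrier Q" "b \<in> carrier Q" using R_closed D_closed by auto
      show ?l
      proof (cases "(a, b) \<in> R \<and> a \<notin> non_divisors Q R w")
        case True
        then obtain c where "c \<in> carrier Q" "(a \<otimes> c, w) \<in> R"
          using ab(1) by (auto simp: non_divisors_def)
        then show ?thesis unfolding comp_iff using related_case[of a b c] True ab by simp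
      next
        case False
        have "b \<in> non_divisors Q R w" if ra: "(a, b) \<in> R" and a: "a \<in> non_divisors Q R w"
        proof -
          have "\<not> (b \<otimes> c, w) \<in> R" if c: "c \<in> carrier Q" for c
            using a c R_trans[OF R_mult[OF ra c]] by (auto simp: non_divisors_def)
          then show ?thesis using ab(2) by (simp add: non_divisors_def)
        qed
        then have "a \<in> non_divisors Q R w" "b \<in> non_divisors Q R w" using r False by auto
        then show ?thesis unfolding comp_iff using D_iff ab by simp
      qed
    qed
  qed
  then show ?thesis unfolding set_eq_iff split_paired_All .
qed

lemma N_subset_non_divisors: "w \<in> carrier Q - N \<Longrightarrow> N \<subseteq> non_divisors Q R w"
  using N_mult N_saturated N_subset by (auto simp: non_divisors_def)

lemma not_in_non_divisors_self: "w \<in> carrier Q \<Longrightarrow> w \<notin> non_divisors Q R w"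
  using R_refl by (auto simp: non_divisors_def intro!: bexI[of _ \<one>])

text \<open>The new socle is the orbit of \<open>w\<close>. A socle element \<open>t\<close> divides
  \<open>w\<close> by some factor \<open>c\<close>; if \<open>c\<close> were in \<open>P\<close>,
  the product would be a non-divisor of \<open>w\<close>, so \<open>c\<close> is a unit. Conversely,
  for \<open>p\<close> in \<open>P\<close> the element \<open>w \<otimes> p\<close> cannot divide
  \<open>w\<close>, by \<open>absorbed_in_N\<close>.\<close>

lemma soccular_congruence_component:
  assumes w: "w \<in> carrier Q - N"
  shows "soccular_congruence Q (coprincipal_component Q P R w) P (non_divisors Q R w)"
proof -
  let ?D = "non_divisors Q R w" and ?C = "coprincipal_component Q P R w"
  have C: "?C = R \<union> ?D \<times> ?D" by (rule coprincipal_component_eq[OF w])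
  have ideal: "a \<otimes> c \<in> ?D" if "a \<in> ?D" "c \<in> carrier Q" for a c
    using that by (auto simp: non_divisors_def m_assoc)
  have sat: "b \<in> ?D" if "(a, b) \<in> R" "a \<in> ?D" for a b
    using that R_mult R_trans R_closed unfolding non_divisors_def by blast
  have ND: "N \<subseteq> ?D" by (rule N_subset_non_divisors[OF w])
  have D: "?D \<subseteq> carrier Q" by (auto simp: non_divisors_def)
  have D_unit: "a \<in> ?D" if af: "a \<otimes> f \<in> ?D" and a: "a \<in> carrier Q" and f: "f \<in> carrier Q - P" for a f
  proof -
    obtain g where g: "g \<in> carrier Q" "(f \<otimes> g, \<one>) \<in> R" using unit[OF f] by blast
    have "a \<otimes> f \<otimes> g \<in> ?D" using ideal af g by blast
    moreover have "(a \<otimes> f \<otimes> g, a) \<in> R"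
      using R_mult_left[OF g(2) a] a f g by (simp add: m_assoc)
    ultimately show ?thesis using sat by blast
  qed
  have "congruence Q ?C" unfolding congruence_def C
    proof (intro conjI allI impI equivI)
      show "R \<union> ?D \<times> ?D \<subseteq> carrier Q \<times> carrier Q" using R_closed D by auto
      show "refl_on (carrier Q) (R \<union> ?D \<times> ?D)" using R_refl by (auto intro!: refl_onI)
      show "sym (R \<union> ?D \<times> ?D)" using R_sym by (auto intro!: symI)
      show "trans (R \<union> ?D \<times> ?D)"
        using R_trans sat R_sym by (intro transI) blast
      show "(a \<otimes> c, b \<otimes> c) \<in> R \<union> ?D \<times> ?D"
        if "(a, b) \<in> R \<union> ?D \<times> ?D \<and> c \<in> carrier Q" for a b c
        using that R_mult ideal by blast
    qed
  then interpret C: monoid_congruence Q ?C by unfold_locales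
  show ?thesis
  proof
    show "prime_ideal Q P" by (fact prime)
    show "monoid_ideal Q ?D" using ideal D by (simp add: monoid_ideal_def)
    show "?C `` {x} = ?D" if "x \<in> ?D" for x
      using sat that by (auto simp: C)
    show "\<exists>n::nat. p [^] n \<in> ?D" if "p \<in> P" for p using P_nilpotent[OF that] ND by blast
    show "\<one> \<notin> ?D" using w R_refl by (auto simp: non_divisors_def)
    show u: "\<exists>g\<in>carrier Q - P. (f \<otimes> g, \<one>) \<in> ?C" if "f \<in> carrier Q - P" for f
      using unit[OF that] by (auto simp: C)
    show "(a, b) \<in> ?C"
      if "a \<in> carrier Q" "b \<in> carrier Q" "f \<in> carrier Q - P" "(a \<otimes> f, b \<otimes> f) \<in> ?C" for a b f
      using u[OF that(3)] C.cancel_unit that by blast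
    show "(f, g) \<in> ?C"
      if "x \<in> carrier Q - ?D" "f \<in> carrier Q - P" "g \<in> carrier Q - P" "(x \<otimes> f, x \<otimes> g) \<in> ?C" for x f g
      using that free[of x f g] D_unit[of x f] ND by (auto simp: C)
    have "w \<in> socle Q P ?D"
    proof -
      have "w \<otimes> p \<in> ?D" if p: "p \<in> P" for p
      proof (rule ccontr)
        have pQ: "p \<in> carrier Q" using p P_subset by blast
        assume "w \<otimes> p \<notin> ?D"
        then obtain c where c: "c \<in> carrier Q" "(w \<otimes> p \<otimes> c, w) \<in> R"
          using w pQ by (auto simp: non_divisors_def)
        then have "w \<in> N" using absorbed_in_N[of w "p \<otimes> c"] P_mult[OF p] w pQ by (simp add: m_assoc)
        then show False using w by blast
      qed
      then show ?thesis using w not_in_non_divisors_self[of w] by (simp add: socle_def)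
    qed
    moreover have "\<exists>f\<in>carrier Q - P. (w \<otimes> f, t) \<in> ?C" if t: "t \<in> socle Q P ?D" for t
    proof -
      have tQ: "t \<in> carrier Q" and tD: "t \<notin> ?D" using t by (auto simp: socle_def)
      then obtain c where c: "c \<in> carrier Q" "(t \<otimes> c, w) \<in> R" by (auto simp: non_divisors_def)
      have "c \<notin> P" using t c sat not_in_non_divisors_self[of w] w by (auto simp: socle_def)
      then obtain f where f: "f \<in> carrier Q - P" "(c \<otimes> f, \<one>) \<in> R" using unit[of c] c by blast
      have "(w \<otimes> f, t \<otimes> (c \<otimes> f)) \<in> R"
        using R_mult[OF R_sym[OF c(2)], of f] tQ c(1) f(1) by (simp add: m_assoc)
      also have "(t \<otimes> (c \<otimes> f), t) \<in> R" using R_mult_left[OF f(2) tQ] tQ by simp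
      finally show ?thesis using f(1) by (auto simp: C)
    qed
    ultimately show "\<exists>s\<in>socle Q P ?D. \<forall>t\<in>socle Q P ?D. \<exists>f\<in>carrier Q - P. (s \<otimes> f, t) \<in> ?C"
      by blast
  qed
qed

section \<open>Separating pairs by soccular components\<close>

text \<open>In the component at \<open>a\<close>, the element \<open>b\<close> is nil and
  \<open>a\<close> is not, and the soccular closure respects this distinction.\<close>

lemma separate_collapsed:
  assumes a: "a \<in> carrier Q - N" and nd: "\<not> (\<exists>c\<in>carrier Q. (b \<otimes> c, a) \<in> R)"
    and b: "b \<in> carrier Q"
  shows "(a, b) \<notin> soccular_component Q P R a" "(b, a) \<notin> soccular_component Q P R a"
proof -
  have "b \<in> non_divisors Q R a" using nd b by (simp add: non_divisors_def)
  moreover have "a \<notin> non_divisors Q R a" using a not_in_non_divisors_self by blast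
  ultimately show "(a, b) \<notin> soccular_component Q P R a" "(b, a) \<notin> soccular_component Q P R a"
    using soccular_congruence.closure_N_saturated[OF soccular_congruence_component[OF a]]
    unfolding soccular_component_def by blast+
qed

lemma iter_collapse_mono: "R \<subseteq> iter_collapse Q P i R"
  by (induction i) (auto simp: iter_collapse_def soccular_collapse_def)

text \<open>The induction finds the collapse that first joins \<open>a\<close> and \<open>b\<close>.
  One of the two is not divisible by the other modulo the preceding collapse, and this one serves as
  \<open>w\<close>.\<close>

lemma separated_if_collapsed:
  assumes c: "(a, b) \<in> iter_collapse Q P i R" and n: "(a, b) \<notin> R"
  shows "\<exists>w. protected_witness Q P R w \<and> (a, b) \<notin> soccular_component Q P R w"
  using c
proof (induction i)
  case 0
  then show ?case using n by (simp add: iter_collapse_def)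
next
  case (Suc i)
  let ?S = "iter_collapse Q P i R"
  interpret S: soccular_congruence Q ?S P N by (rule soccular_congruence_iter_collapse)
  show ?case
  proof (cases "(a, b) \<in> ?S")
    case True
    then show ?thesis by (rule Suc.IH)
  next
    case False
    have ab: "(a, b) \<in> soccular_collapse Q P ?S" using Suc.prems by (simp add: iter_collapse_def)
    interpret C: soccular_congruence Q "soccular_collapse Q P ?S" P N by (rule S.soccular_congruence_collapse)
    have cl: "a \<in> carrier Q - N" "b \<in> carrier Q - N" using ab False by (auto simp: S.collapse_eq)
    have False': "(b, a) \<notin> ?S" using False S.R_sym by blast
    show ?thesis
    proof (cases "\<exists>c\<in>carrier Q. (b \<otimes> c, a) \<in> ?S")
      case nd: False
      then have "protected_witness Q P R a"
        using S.collapse_key_witness[OF ab False] by (auto simp: protected_witness_def)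
      \<comment> \<open>The component is taken for \<open>R\<close>, not for the collapse;
        non-divisibility passes down to the finer relation.\<close>
      moreover have "\<not> (\<exists>c\<in>carrier Q. (b \<otimes> c, a) \<in> R)" using nd iter_collapse_mono by blast
      ultimately show ?thesis using separate_collapsed(1)[of a b] cl by blast
    next
      case True
      then have nd: "\<not> (\<exists>c\<in>carrier Q. (a \<otimes> c, b) \<in> ?S)"
        using S.collapse_not_mutually_dividing[OF ab False] by blast
      then have "protected_witness Q P R b"
        using S.collapse_key_witness[OF C.R_sym[OF ab] False'] by (auto simp: protected_witness_def)
      moreover have "\<not> (\<exists>c\<in>carrier Q. (a \<otimes> c, b) \<in> R)" using nd iter_collapse_mono by blast
      ultimately show ?thesis using separate_collapsed(2)[of b a] cl by blast
    qed
  qed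
qed

text \<open>A key witness for any collapse is outside \<open>N\<close>, which all collapses share,
  so \<open>coprincipal_component_eq\<close> applies at \<open>w\<close>.\<close>

lemma R_subset_soccular_component:
  assumes "protected_witness Q P R w"
  shows "R \<subseteq> soccular_component Q P R w"
proof -
  obtain i where k: "key_witness Q P (iter_collapse Q P i R) w"
    using assms by (auto simp: protected_witness_def)
  interpret S: soccular_congruence Q "iter_collapse Q P i R" P N by (rule soccular_congruence_iter_collapse)
  have "w \<in> carrier Q - N" by (rule S.key_witness_not_in_N[OF k])
  then show ?thesis
    unfolding soccular_component_def soccular_closure_def by (auto simp: coprincipal_component_eq)
qed

text \<open>Every element off \<open>N\<close> divides a socle element \<open>s\<close> modulo
  \<open>R\<close>, so the coprincipal component at \<open>s\<close> is \<open>R\<close>. A pair in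
  its soccular component therefore lies in some collapse of \<open>R\<close>, and
  \<open>separated_if_collapsed\<close> applies unless the pair is in \<open>R\<close>.\<close>

lemma eq_Inter_soccular_components:
  assumes noeth: "noetherian_monoid Q"
  shows "R = (carrier Q \<times> carrier Q) \<inter>
               (\<Inter>w \<in> {w. protected_witness Q P R w}. soccular_component Q P R w)"
proof (intro equalityI subsetI)
  fix x assume "x \<in> R"
  then show "x \<in> (carrier Q \<times> carrier Q) \<inter>
      (\<Inter>w \<in> {w. protected_witness Q P R w}. soccular_component Q P R w)"
    using R_closed R_subset_soccular_component by (cases x) blast
next
  fix x assume x: "x \<in> (carrier Q \<times> carrier Q) \<inter>
      (\<Inter>w \<in> {w. protected_witness Q P R w}. soccular_component Q P R w)"
  obtain a b where ab: "x = (a, b)" by (cases x)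
  obtain s where s: "s \<in> socle Q P N" using socle_orbit by blast
  then have sN: "s \<in> carrier Q - N" by (simp add: socle_def)
  have div: "\<exists>c\<in>carrier Q. (a \<otimes> c, s) \<in> R" if a: "a \<in> carrier Q - N" for a
  proof -
    obtain m where m: "m \<in> carrier Q" "a \<otimes> m \<in> socle Q P N"
      using exists_socle_multiple[OF noeth a] by blast
    then obtain c where "c \<in> carrier Q" "(a \<otimes> m \<otimes> c, s) \<in> R"
      using socle_transitive[OF m(2) s] by blast
    then show ?thesis using a m(1) by (auto simp: m_assoc intro!: bexI[of _ "m \<otimes> c"])
  qed
  \<comment> \<open>Index 0 is the one used: a cogenerator is a key witness for \<open>R\<close>
    itself.\<close>
  have "key_witness Q P (iter_collapse Q P 0 R) s"
    using iffD2[OF cogenerator_iff s] by (simp add: iter_collapse_def cogenerator_def)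
  then have "protected_witness Q P R s" unfolding protected_witness_def by blast
  then have "(a, b) \<in> soccular_component Q P R s" using x by (auto simp: ab)
  moreover have "non_divisors Q R s = N"
    using N_subset_non_divisors[OF sN] div by (auto simp: non_divisors_def)
  then have "coprincipal_component Q P R s = R"
    using coprincipal_component_eq[OF sN] N_related by auto
  ultimately obtain i where "(a, b) \<in> iter_collapse Q P i R"
    unfolding soccular_component_def soccular_closure_eq_Union by auto
  then show "x \<in> R" using separated_if_collapsed x by (auto simp: ab)
qed

end

section \<open>Coprincipal congruences\<close>

text \<open>The guard on \<open>P\<close> empties the set when \<open>P = {}\<close>, as
  \<open>primary_congruence\<close> demands of \<open>N\<close>, even if the quotient is
  trivial.\<close>

definition nil_elements :: "('a, 'm) monoid_scheme \<Rightarrow> 'a set \<Rightarrow> 'a rel \<Rightarrow> 'a set" where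
  "nil_elements Q P R = {x \<in> carrier Q. P \<noteq> {} \<and> is_nil (quot Q R) (R `` {x})}"

text \<open>Two nil elements are related through their product, so they form one class. The
  hypothesis \<open>one\<close> sets aside the universal congruence with nonempty
  \<open>P\<close>.\<close>

lemma primary_congruence_nil_elements:
  fixes Q (structure)
  assumes Q: "comm_monoid Q" and R: "primary Q P R" and one: "\<one> \<notin> nil_elements Q P R"
  shows "primary_congruence Q R P (nil_elements Q P R)"
proof -
  let ?N = "nil_elements Q P R"
  interpret comm_monoid Q by fact
  have "congruence Q R" using R by (simp add: primary_def)
  then interpret monoid_congruence Q R by unfold_locales
  have P: "P \<subseteq> carrier Q" using R by (simp add: primary_def prime_ideal_def monoid_ideal_def)
  have N: "x \<in> ?N \<longleftrightarrow> x \<in> carrier Q \<and> P \<noteq> {} \<and> (\<forall>c\<in>carrier Q. (x \<otimes> c, x) \<in> R)" for x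
    using is_nil_quot_iff[of x] by (auto simp: nil_elements_def)
  have saturated: "y \<in> ?N" if x: "x \<in> ?N" and xy: "(x, y) \<in> R" for x y
  proof -
    have "(y \<otimes> c, y) \<in> R" if c: "c \<in> carrier Q" for c
    proof -
      have "(y \<otimes> c, x \<otimes> c) \<in> R" using R_mult[OF R_sym c] xy .
      also have "(x \<otimes> c, x) \<in> R" using x c N by blast
      also note xy
      finally show ?thesis .
    qed
    then show ?thesis using x R_closed(2)[OF xy] unfolding N by blast
  qed
  have related: "(x, y) \<in> R" if "x \<in> ?N" "y \<in> ?N" for x y
  proof -
    have "(x \<otimes> y, x) \<in> R" "(x \<otimes> y, y) \<in> R" using that m_comm[of x y] by (auto simp: N)
    then show ?thesis using R_sym R_trans by blast
  qed
  show ?thesis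
  proof
    show "prime_ideal Q P" using R by (simp add: primary_def)
    show "monoid_ideal Q ?N" unfolding monoid_ideal_def
    proof (intro conjI ballI)
      show "?N \<subseteq> carrier Q" by (auto simp: nil_elements_def)
      fix x c assume x: "x \<in> ?N" and c: "c \<in> carrier Q"
      then have "(x \<otimes> c, x) \<in> R" using N[of x] by blast
      then show "x \<otimes> c \<in> ?N" by (rule saturated[OF x R_sym])
    qed
    show "R `` {x} = ?N" if "x \<in> ?N" for x
      using that saturated related by blast
    show "\<one> \<notin> ?N" by (rule one)
    show "\<exists>n::nat. p [^] n \<in> ?N" if "p \<in> P" for p
    proof -
      have p: "p \<in> carrier Q" "P \<noteq> {}" using P that by auto
      have "nilpotent (quot Q R) (R `` {p})" using R that by (simp add: primary_def)
      then obtain n :: nat where "\<forall>c\<in>carrier Q. (p [^] n \<otimes> c, p [^] n) \<in> R"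
        using nilpotent_quot_iff[OF p(1)] by auto
      then show ?thesis using p N[of "p [^] n"] by (intro exI[of _ n]) simp
    qed
    show "(a, b) \<in> R"
      if "a \<in> carrier Q" "b \<in> carrier Q" "f \<in> carrier Q - P" "(a \<otimes> f, b \<otimes> f) \<in> R" for a b f
    proof -
      have "cancellative (quot Q R) (R `` {f})" using R that(3) by (simp add: primary_def)
      then show ?thesis using cancellative_quot_iff[of f] that by simp
    qed
  qed
qed

text \<open>For nonempty \<open>P\<close> this is partial cancellativity of the class of
  \<open>x\<close>, applied to the cancellative classes of \<open>f\<close> and \<open>g\<close>.
  For empty \<open>P\<close>, \<open>x\<close> itself cancels.\<close>

lemma (in primary_congruence) mesoprimary_free:
  assumes R: "mesoprimary Q P R" and x: "x \<in> carrier Q - N"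
    and f: "f \<in> carrier Q - P" and g: "g \<in> carrier Q - P" and r: "(x \<otimes> f, x \<otimes> g) \<in> R"
  shows "(f, g) \<in> R"
proof (cases "P = {}")
  case True
  then show ?thesis using cancel[of f g x] x f g r by (simp add: m_comm)
next
  case False
  have canc: "cancellative (quot Q R) (R `` {h})" if "h \<in> carrier Q - P" for h
    using that cancellative_quot_iff[of h] cancel by blast
  have "partly_cancellative (quot Q R) (R `` {x})"
    using R x unfolding mesoprimary_def carrier_quot by blast
  moreover have "\<not> is_nil (quot Q R) (R `` {x \<otimes> f})"
    using is_nil_quot_iff_N[OF False] mult_unit_in_N_iff x f by simp
  moreover have "R `` {x} \<otimes>\<^bsub>quot Q R\<^esub> R `` {f} = R `` {x \<otimes> f}"
    "R `` {x} \<otimes>\<^bsub>quot Q R\<^esub> R `` {g} = R `` {x \<otimes> f}"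
    using x f g r by (simp_all add: mult_class class_eq_iff R_sym)
  ultimately have "R `` {f} = R `` {g}"
    using canc[OF f] canc[OF g] unfolding partly_cancellative_def by metis
  then show ?thesis using class_eq_iff f g by blast
qed

text \<open>Socle elements are cogenerators, so they divide each other, with factors off
  \<open>P\<close> because the results are not nil. To invert \<open>f\<close>, move a socle element
  \<open>s\<close> by \<open>f\<close>, return to \<open>s\<close> by some \<open>g\<close>, and
  apply freeness at \<open>s\<close>.\<close>

lemma (in primary_congruence) coprincipal_imp_soccular:
  assumes noeth: "noetherian_monoid Q" and R: "coprincipal Q P R"
  shows "soccular_congruence Q R P N"
proof -
  have meso: "mesoprimary Q P R" using R by (simp add: coprincipal_def)
  have orbit: "\<exists>c\<in>carrier Q - P. (s \<otimes> c, t) \<in> R"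
    if s: "s \<in> socle Q P N" and t: "t \<in> socle Q P N" for s t
  proof -
    have st: "s \<in> carrier Q" "t \<in> carrier Q" "t \<notin> N" using s t by (auto simp: socle_def)
    have "pideal (quot Q R) (R `` {s}) = pideal (quot Q R) (R `` {t})"
      using R s t unfolding coprincipal_def cogenerator_iff by blast
    then have "green_le (quot Q R) (R `` {s}) (R `` {t})" by (simp add: green_le_def)
    then obtain c where c: "c \<in> carrier Q" "(s \<otimes> c, t) \<in> R"
      using green_le_quot_iff st by blast
    then have "c \<notin> P" using s st N_saturated by (auto simp: socle_def)
    then show ?thesis using c by blast
  qed
  obtain s where s: "s \<in> socle Q P N"
    using exists_socle_multiple[OF noeth, of \<one>] one_not_N by auto
  then have sN: "s \<in> carrier Q - N" by (simp add: socle_def)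
  show ?thesis
  proof
    show "(f, g) \<in> R" if "x \<in> carrier Q - N" "f \<in> carrier Q - P" "g \<in> carrier Q - P"
      "(x \<otimes> f, x \<otimes> g) \<in> R" for x f g
      using mesoprimary_free[OF meso that] .
    show "\<exists>s\<in>socle Q P N. \<forall>t\<in>socle Q P N. \<exists>f\<in>carrier Q - P. (s \<otimes> f, t) \<in> R"
      using s orbit by blast
    fix f assume f: "f \<in> carrier Q - P"
    have "s \<otimes> f \<in> socle Q P N" using socle_mult_unit_iff[of s f] s sN f by blast
    then obtain g where g: "g \<in> carrier Q - P" "(s \<otimes> f \<otimes> g, s) \<in> R" using orbit s by blast
    then have "(s \<otimes> (f \<otimes> g), s \<otimes> \<one>) \<in> R" using sN f by (simp add: m_assoc)
    then have "(f \<otimes> g, \<one>) \<in> R"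
      using mesoprimary_free[OF meso sN compl_P_mult[OF f g(1)] one_not_P] by blast
    then show "\<exists>g\<in>carrier Q - P. (f \<otimes> g, \<one>) \<in> R" using g(1) by blast
  qed
qed

text \<open>No collapse can enlarge the universal congruence, and an aide needs two distinct
  classes. Nonempty \<open>P\<close> is what forces an aide to exist.\<close>

lemma no_protected_witness_universal:
  assumes Q: "comm_monoid Q" and P: "monoid_ideal Q P" "P \<noteq> {}"
  shows "\<not> protected_witness Q P (carrier Q \<times> carrier Q) w"
proof
  let ?U = "carrier Q \<times> carrier Q"
  interpret comm_monoid Q by fact
  interpret monoid_congruence Q ?U
    by unfold_locales (auto simp: congruence_def intro!: equivI refl_onI symI transI)
  have "soccular_collapse Q P ?U = ?U" by (auto simp: soccular_collapse_def)
  then have "iter_collapse Q P i ?U = ?U" for i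
    by (induction i) (auto simp: iter_collapse_def)
  moreover assume "protected_witness Q P ?U w"
  ultimately obtain q where wq: "q \<in> carrier Q" "w \<in> carrier Q" and "key_aide Q P ?U q w"
    by (auto simp: protected_witness_def key_witness_def)
  then have "\<forall>p\<in>P. aide Q ?U q w p"
    using key_aide_iff[OF Q cong P(1)] by blast
  then obtain p where "aide Q ?U q w p" using P(2) by blast
  then show False using wq by (auto simp: aide_def)
qed

theorem theorem4p2:
  fixes Q :: "('a, 'm) monoid_scheme" and P :: "'a set" and R :: "'a rel"
  assumes "comm_monoid Q"
    and "noetherian_monoid Q"
    and "coprincipal Q P R"
  shows "R = (carrier Q \<times> carrier Q) \<inter>
               (\<Inter>w \<in> {w. protected_witness Q P R w}. soccular_component Q P R w)"
proof -
  interpret comm_monoid Q by fact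
  have primary: "primary Q P R"
    using assms(3) by (simp add: coprincipal_def mesoprimary_def)
  then have "congruence Q R" by (simp add: primary_def)
  then interpret monoid_congruence Q R by unfold_locales
  show ?thesis
  proof (cases "\<one>\<^bsub>Q\<^esub> \<in> nil_elements Q P R")
    case True
    then have P: "P \<noteq> {}" and nil: "\<forall>c\<in>carrier Q. (c, \<one>\<^bsub>Q\<^esub>) \<in> R"
      using is_nil_quot_iff[of "\<one>\<^bsub>Q\<^esub>"] by (auto simp: nil_elements_def)
    have "monoid_ideal Q P" using primary by (simp add: primary_def prime_ideal_def)
    moreover have "R = carrier Q \<times> carrier Q"
    proof (intro equalityI subrelI)
      fix a b assume "(a, b) \<in> carrier Q \<times> carrier Q"
      then have "(a, \<one>\<^bsub>Q\<^esub>) \<in> R" "(b, \<one>\<^bsub>Q\<^esub>) \<in> R" using nil by auto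
      then show "(a, b) \<in> R" using R_sym R_trans by blast
    qed (use R_closed in blast)
    \<comment> \<open>The intersection runs over the empty family, and the factor
      \<open>carrier Q \<times> carrier Q\<close> is what remains.\<close>
    ultimately show ?thesis
      using no_protected_witness_universal[OF assms(1) _ P] by auto
  next
    case False
    interpret primary_congruence Q R P "nil_elements Q P R"
      by (rule primary_congruence_nil_elements[OF assms(1) primary False])
    interpret soccular_congruence Q R P "nil_elements Q P R"
      by (rule coprincipal_imp_soccular[OF assms(2,3)])
    show ?thesis by (rule eq_Inter_soccular_components[OF assms(2)])
  qed
qed

end
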